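(* For each of the two families, the mirror of local $\mathbb{P}^2$ and the mirror of local $\mathbb{F}_2$, the Gauss-Manin Lie algebra $\mathfrak{G}$ on the corresponding (local) moduli space $\mathsf{T}$ of enhanced non-compact Calabi-Yau threefolds has a Lie subalgebra isomorphic to $\mathfrak{sl}_2(\mathbb{C})$.
   Context: **General definitions.** In both cases $\mathcal{H}$ is the bundle with fibres $H^3(X_z,\mathbb{C})$ over the complex-structure moduli space, with flat Gauss-Manin connection $\nabla$, Hodge filtration $F^\bullet$, weight filtration $W_\bullet$, and a pairing. $\omega$ is a fixed frame and $\mathsf{G}$ is the group of matrices $S$ listed below, which are the changes of basis preserving both filtrations and the pairing on the graded pieces $\mathrm{Gr}^W_i$ (with the entry $s_{11}$ normalized to 1). The moduli space is taken locally: $\mathsf{T}=V_0\times U_0$ with $V_0$ an open set in the space of $z$-parameters and $U_0$ a neighbourhood of $S=\mathrm{Id}$ in $\mathsf{G}$. On $\mathsf{T}$ one has the frame $\omega_{\mathsf{t}}=S\omega$, and if $\nabla\omega=A_{GM}\,\omega$, then $\nabla\omega_{\mathsf{t}}=(dS+SA_{GM})S^{-1}\omega_{\mathsf{t}}$. For $\mathfrak{g}\in\mathrm{Lie}(\mathsf{G})$, $\mathsf{R}_{\mathfrak{g}}$ is the unique vector field on $\mathsf{T}$ with $\nabla_{\mathsf{R}_{\mathfrak{g}}}\omega_{\mathsf{t}}=\mathfrak{g}\,\omega_{\mathsf{t}}$. The Gauss-Manin Lie algebra $\mathfrak{G}$ is the $\mathcal{O}_{\mathsf{T}}$-module generated by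 the vector fields $\mathsf{R}_{\mathfrak{g}}$, $\mathfrak{g}\in\mathrm{Lie}(\mathsf{G})$, and the modular vector fields listed below, with the commutator of vector fields as bracket. **Mirror of local $\mathbb{P}^2$.** $X_z=\{uv+a_0+a_1t_1+a_2t_2+\frac{a_3}{t_1t_2}=0\}\subset\mathbb{C}^2\times(\mathbb{C}^* )^2$, $z=-a_1a_2a_3/a_0^3$, $\theta=z\frac{d}{dz}$, $Y_{111}=-\frac{1}{3(1-27z)}$, and $\Omega$ the holomorphic 3-form, with Picard-Fuchs operator $(\theta^2-3z(3\theta+1)(3\theta+2))\theta$. Frame $\omega=(\Omega,\nabla_\theta\Omega,Y_{111}^{-1}\nabla_\theta^2\Omega)^{\rm tr}$ with $$\nabla_\theta\omega=\begin{pmatrix}0&1&0\\0&0&Y_{111}\\0&-18z&0\end{pmatrix}\omega,\qquad S=\begin{pmatrix}1&0&0\\0&s_{33}^{-1}&0\\0&s_{32}&s_{33}\end{pmatrix}.$$ The modular vector field $\mathsf{R}$ is the one with $\nabla_{\mathsf{R}}\omega_{\mathsf{t}}=\begin{pmatrix}0&Y^{-1}(\mathsf{t})&0\\0&0&1\\0&0&0\end{pmatrix}\omega_{\mathsf{t}}$ for some function $Y(\mathsf{t})$ on $\mathsf{T}$. **Mirror of local $\mathbb{F}_2$.** $X_z=\{uv+a_0+a_1t_1+a_2t_2+\frac{a_3}{t_1}+\frac{a_4}{t_1^2t_2}=0\}\subset\mathbb{C}^2\times(\mathbb{C}^* )^2$, $z_1=\frac{a_1a_3}{a_0^2}$, $z_2=\frac{a_2a_4}{a_3^2}$,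 $\theta_i=z_i\frac{\partial}{\partial z_i}$, $Y_{111}=\frac{1}{(1-4z_1)^2-64z_1^2z_2}$, and $\Omega$ the holomorphic 3-form. The connection $\nabla$ is determined by the Picard-Fuchs system $\mathcal{L}_1\Omega=\mathcal{L}_2\Omega=0$ (with $\theta_i$ acting as $\nabla_{\theta_i}$), $\mathcal{L}_1=\theta_1(\theta_1-2\theta_2)-2z_1(2\theta_1+1)\theta_1$, $\mathcal{L}_2=\theta_2^2-z_2(\theta_1-2\theta_2-1)(\theta_1-2\theta_2)$. Frame $\omega=(\Omega,\nabla_{\theta_1-2\theta_2}\Omega,\nabla_{\theta_1}\Omega,Y_{111}^{-1}\nabla_{\theta_1}^2\Omega)^{\rm tr}$ and $$S=\begin{pmatrix}1&0&0&0\\0&s_{22}&s_{23}&0\\0&0&s_{44}^{-1}&0\\0&0&s_{43}&s_{44}\end{pmatrix}.$$ The modular vector fields $\mathsf{R}_1,\mathsf{R}_2$ are those with $$\nabla_{\mathsf{R}_1}\omega_{\mathsf{t}}=\begin{pmatrix}0&Y_1^{-1}&Y_2^{-1}&0\\0&0&0&0\\0&0&0&1\\0&0&0&0\end{pmatrix}\omega_{\mathsf{t}},\qquad \nabla_{\mathsf{R}_2}\omega_{\mathsf{t}}=\begin{pmatrix}0&Y_3^{-1}&Y_4^{-1}&0\\0&0&0&1\\0&0&0&0\\0&0&0&0\end{pmatrix}\omega_{\mathsf{t}}$$ for some functions $Y_i$ on $\mathsf{T}$. *)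

theory Defs
  imports "HOL-Analysis.Analysis"
begin

section \<open>Holomorphic vector fields on an open subset of a complex coordinate space\<close>

definition holo_on :: "(complex^'n) set \<Rightarrow> (complex^'n \<Rightarrow> complex) \<Rightarrow> bool" where
  "holo_on T f \<longleftrightarrow>
     (\<forall>x\<in>T. \<exists>c::complex^'n. (f has_derivative (\<lambda>h. \<Sum>i\<in>UNIV. c $ i * h $ i)) (at x))"

text \<open>Vector fields are extended by zero outside \<open>T\<close>, so that equality of vector fields
  on \<open>T\<close> is equality of functions.\<close>

definition vfields :: "(complex^'n) set \<Rightarrow> (complex^'n \<Rightarrow> complex^'n) set" where
  "vfields T = {v. (\<forall>i. holo_on T (\<lambda>x. v x $ i)) \<and> (\<forall>x. x \<notin> T \<longrightarrow> v x = 0)}"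

definition vbracket ::
  "(complex^'n) set \<Rightarrow> (complex^'n \<Rightarrow> complex^'n) \<Rightarrow> (complex^'n \<Rightarrow> complex^'n) \<Rightarrow>
     complex^'n \<Rightarrow> complex^'n" where
  "vbracket T v w = (\<lambda>x. if x \<in> T
     then frechet_derivative w (at x) (v x) - frechet_derivative v (at x) (w x) else 0)"

definition module_span ::
  "(complex^'n) set \<Rightarrow> (complex^'n \<Rightarrow> complex^'n) set \<Rightarrow> (complex^'n \<Rightarrow> complex^'n) set" where
  "module_span T X = {v. \<exists>F c. finite F \<and> F \<subseteq> X \<and> (\<forall>r\<in>F. holo_on T (c r)) \<and>
     v = (\<lambda>x. \<Sum>r\<in>F. c r x *s r x)}"


section \<open>Lie subalgebras isomorphic to \<open>sl\<^sub>2\<close>\<close>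

definition lie_subalgebra ::
  "(complex^'n) set \<Rightarrow> (complex^'n \<Rightarrow> complex^'n) set \<Rightarrow> (complex^'n \<Rightarrow> complex^'n) set \<Rightarrow> bool" where
  "lie_subalgebra T L \<GG> \<longleftrightarrow> L \<subseteq> \<GG> \<and> (\<lambda>x. 0) \<in> L \<and>
     (\<forall>v\<in>L. \<forall>w\<in>L. (\<lambda>x. v x + w x) \<in> L) \<and>
     (\<forall>a. \<forall>v\<in>L. (\<lambda>x. a *s v x) \<in> L) \<and>
     (\<forall>v\<in>L. \<forall>w\<in>L. vbracket T v w \<in> L)"

definition scale_mat :: "complex \<Rightarrow> complex^'m^'k \<Rightarrow> complex^'m^'k" where
  "scale_mat a M = (\<chi> i j. a * M $ i $ j)"

definition sl2 :: "(complex^2^2) set" where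
  "sl2 = {M. trace M = 0}"

definition isomorphic_sl2 ::
  "(complex^'n) set \<Rightarrow> (complex^'n \<Rightarrow> complex^'n) set \<Rightarrow> bool" where
  "isomorphic_sl2 T L \<longleftrightarrow> (\<exists>\<phi>. bij_betw \<phi> sl2 L \<and>
     (\<forall>M\<in>sl2. \<forall>N\<in>sl2. \<phi> (M + N) = (\<lambda>x. \<phi> M x + \<phi> N x)) \<and>
     (\<forall>a. \<forall>M\<in>sl2. \<phi> (scale_mat a M) = (\<lambda>x. a *s \<phi> M x)) \<and>
     (\<forall>M\<in>sl2. \<forall>N\<in>sl2. \<phi> (M ** N - N ** M) = vbracket T (\<phi> M) (\<phi> N)))"


section \<open>Matrix groups and the connection in a moving frame\<close>

text \<open>The Lie algebra of a matrix group as its tangent space at the identity.\<close>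

definition Lie :: "(complex^'m^'m) set \<Rightarrow> (complex^'m^'m) set" where
  "Lie G = {g. \<exists>\<gamma>::complex \<Rightarrow> complex^'m^'m. \<gamma> 0 = mat 1 \<and> (\<forall>\<^sub>F t in nhds 0. \<gamma> t \<in> G) \<and>
     (\<forall>i j. ((\<lambda>t. \<gamma> t $ i $ j) has_field_derivative g $ i $ j) (at 0))}"

text \<open>If \<open>A x v\<close> is the value at \<open>x\<close> on the tangent vector \<open>v\<close> of the connection matrix of a
  frame \<open>\<omega>\<close>, that is \<open>\<nabla>\<^sub>v \<omega> = A x v \<omega>\<close>, the following is the connection matrix
  \<open>(dS + S A) S\<^sup>-\<^sup>1\<close> of the frame \<open>S \<omega>\<close>.\<close>

definition frame_change ::
  "(complex^'n \<Rightarrow> complex^'m^'m) \<Rightarrow> (complex^'n \<Rightarrow> complex^'n \<Rightarrow> complex^'m^'m) \<Rightarrow>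
     complex^'n \<Rightarrow> complex^'n \<Rightarrow> complex^'m^'m" where
  "frame_change S A x v =
     (frechet_derivative S (at x) v + S x ** A x v) ** matrix_inv (S x)"

text \<open>The vector fields \<open>R\<close> on \<open>T\<close> with \<open>\<nabla>\<^sub>R \<omega>\<^sub>t = M \<omega>\<^sub>t\<close>, where \<open>B\<close> is the connection
  matrix of the frame \<open>\<omega>\<^sub>t\<close>.\<close>

definition fields_with_matrix ::
  "(complex^'n) set \<Rightarrow> (complex^'n \<Rightarrow> complex^'n \<Rightarrow> complex^'m^'m) \<Rightarrow>
     (complex^'n \<Rightarrow> complex^'m^'m) \<Rightarrow> (complex^'n \<Rightarrow> complex^'n) set" where
  "fields_with_matrix T B M = {R \<in> vfields T. \<forall>x\<in>T. B x (R x) = M x}"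


section \<open>Mirror of local \<open>P\<^sup>2\<close>\<close>

text \<open>The group is parametrized by \<open>s\<^sub>3\<^sub>2\<close> and \<open>s\<^sub>3\<^sub>3 \<noteq> 0\<close>; the coordinates of a point
  \<open>t\<close> of the moduli space are \<open>(z, s\<^sub>3\<^sub>2, s\<^sub>3\<^sub>3)\<close>.\<close>

definition P2_base :: "complex set" where
  "P2_base = {z. z \<noteq> 0 \<and> 1 - 27 * z \<noteq> 0}"

definition P2_Y111 :: "complex \<Rightarrow> complex" where
  "P2_Y111 z = - 1 / (3 * (1 - 27 * z))"

definition P2_Smat :: "complex \<Rightarrow> complex \<Rightarrow> complex^3^3" where
  "P2_Smat s32 s33 = vector [
     vector [1, 0, 0],
     vector [0, inverse s33, 0],
     vector [0, s32, s33]]"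

definition P2_group :: "(complex^3^3) set" where
  "P2_group = {P2_Smat s32 s33 | s32 s33. s33 \<noteq> 0}"

definition P2_S :: "complex^3 \<Rightarrow> complex^3^3" where
  "P2_S t = P2_Smat (t $ 2) (t $ 3)"

definition P2_moduli :: "complex set \<Rightarrow> (complex^3^3) set \<Rightarrow> (complex^3) set" where
  "P2_moduli V0 U0 = {t. t $ 1 \<in> V0 \<and> t $ 3 \<noteq> 0 \<and> P2_S t \<in> U0}"

definition P2_theta_mat :: "complex \<Rightarrow> complex^3^3" where
  "P2_theta_mat z = vector [
     vector [0, 1, 0],
     vector [0, 0, P2_Y111 z],
     vector [0, - 18 * z, 0]]"

text \<open>The connection form is \<open>P2_theta_mat z dz/z\<close>.\<close>

definition P2_conn :: "complex^3 \<Rightarrow> complex^3 \<Rightarrow> complex^3^3" where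
  "P2_conn t v = scale_mat (v $ 1 / t $ 1) (P2_theta_mat (t $ 1))"

text \<open>The function \<open>Y\<close> in the modular vector field is only required to be a function on the
  moduli space, and may have poles; at a pole the convention \<open>inverse 0 = 0\<close> lets the value
  \<open>0\<close> of \<open>Y\<close> represent \<open>Y\<^sup>-\<^sup>1 = 0\<close>. The same applies to the \<open>Y\<^sub>i\<close> below.\<close>

definition P2_modular_mat :: "complex \<Rightarrow> complex^3^3" where
  "P2_modular_mat y = vector [
     vector [0, inverse y, 0],
     vector [0, 0, 1],
     vector [0, 0, 0]]"

definition P2_gauss_manin :: "complex set \<Rightarrow> (complex^3^3) set \<Rightarrow> (complex^3 \<Rightarrow> complex^3) set" where
  "P2_gauss_manin V0 U0 =
     (let T = P2_moduli V0 U0; B = frame_change P2_S P2_conn in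
      module_span T
        ((\<Union>g\<in>Lie P2_group. fields_with_matrix T B (\<lambda>_. g)) \<union>
         (\<Union>Y. fields_with_matrix T B (\<lambda>t. P2_modular_mat (Y t)))))"


section \<open>Mirror of local \<open>F\<^sub>2\<close>\<close>

text \<open>The factor \<open>1 - 4 z\<^sub>2\<close> is the second component of the discriminant: solving the
  Picard--Fuchs system for \<open>\<theta>\<^sub>2\<^sup>2 \<Omega>\<close> requires dividing by it.\<close>

definition F2_base :: "(complex^2) set" where
  "F2_base = {z. z $ 1 \<noteq> 0 \<and> z $ 2 \<noteq> 0 \<and> 1 - 4 * z $ 2 \<noteq> 0 \<and>
     (1 - 4 * z $ 1)^2 - 64 * (z $ 1)^2 * z $ 2 \<noteq> 0}"

definition F2_Y111 :: "complex^2 \<Rightarrow> complex" where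
  "F2_Y111 z = 1 / ((1 - 4 * z $ 1)^2 - 64 * (z $ 1)^2 * z $ 2)"

text \<open>A section \<open>\<Sum>\<^sub>k \<sigma>\<^sub>k \<omega>\<^sub>k\<close> is represented by the row vector \<open>\<sigma>\<close> of its coefficients in the
  frame \<open>\<omega>\<close>. If \<open>\<nabla>\<close> along \<open>\<theta>\<^sub>i\<close> maps \<open>\<omega>\<close> to \<open>A i \<omega>\<close>, it acts on \<open>\<sigma>\<close> as follows.\<close>

definition F2_nabla ::
  "(2 \<Rightarrow> complex^2 \<Rightarrow> complex^4^4) \<Rightarrow> 2 \<Rightarrow> (complex^2 \<Rightarrow> complex^4) \<Rightarrow> complex^2 \<Rightarrow> complex^4" where
  "F2_nabla A i \<sigma> z =
     z $ i *s frechet_derivative \<sigma> (at z) (axis i 1) + \<sigma> z v* A i z"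

text \<open>\<open>A 1\<close>, \<open>A 2\<close> are the matrices of the Gauss--Manin connection along \<open>\<theta>\<^sub>1\<close>, \<open>\<theta>\<^sub>2\<close> in the
  frame \<open>\<omega>\<close>: a flat holomorphic connection for which the first frame element \<open>\<Omega>\<close> satisfies the
  Picard--Fuchs system and the others are the derivatives of \<open>\<Omega>\<close> in the definition of \<open>\<omega>\<close>.\<close>

definition F2_connection ::
  "(complex^2) set \<Rightarrow> (2 \<Rightarrow> complex^2 \<Rightarrow> complex^4^4) \<Rightarrow> bool" where
  "F2_connection V0 A \<longleftrightarrow>
     (let \<Omega> = (\<lambda>_. axis 1 1);
          D1 = F2_nabla A 1;
          D2 = F2_nabla A 2;
          D12 = (\<lambda>\<sigma> z. D1 \<sigma> z - 2 *s D2 \<sigma> z)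
      in
      (\<forall>i k l. holo_on V0 (\<lambda>z. A i z $ k $ l)) \<and>
      (\<forall>z\<in>V0.
         (\<forall>k. D1 (D2 (\<lambda>_. axis k 1)) z = D2 (D1 (\<lambda>_. axis k 1)) z) \<and>
         D12 \<Omega> z = axis 2 1 \<and>
         D1 \<Omega> z = axis 3 1 \<and>
         inverse (F2_Y111 z) *s D1 (D1 \<Omega>) z = axis 4 1 \<and>
         D1 (D12 \<Omega>) z - (2 * z $ 1) *s (2 *s D1 (D1 \<Omega>) z + D1 \<Omega> z) = 0 \<and>
         D2 (D2 \<Omega>) z - z $ 2 *s (D12 (D12 \<Omega>) z - D12 \<Omega> z) = 0))"

text \<open>The group is parametrized by \<open>s\<^sub>2\<^sub>2 \<noteq> 0\<close>, \<open>s\<^sub>2\<^sub>3\<close>, \<open>s\<^sub>4\<^sub>3\<close>, \<open>s\<^sub>4\<^sub>4 \<noteq> 0\<close>; the coordinates of a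
  point \<open>t\<close> of the moduli space are \<open>(z\<^sub>1, z\<^sub>2, s\<^sub>2\<^sub>2, s\<^sub>2\<^sub>3, s\<^sub>4\<^sub>3, s\<^sub>4\<^sub>4)\<close>.\<close>

definition F2_Smat :: "complex \<Rightarrow> complex \<Rightarrow> complex \<Rightarrow> complex \<Rightarrow> complex^4^4" where
  "F2_Smat s22 s23 s43 s44 = vector [
     vector [1, 0, 0, 0],
     vector [0, s22, s23, 0],
     vector [0, 0, inverse s44, 0],
     vector [0, 0, s43, s44]]"

definition F2_group :: "(complex^4^4) set" where
  "F2_group = {F2_Smat s22 s23 s43 s44 | s22 s23 s43 s44. s22 \<noteq> 0 \<and> s44 \<noteq> 0}"

definition F2_S :: "complex^6 \<Rightarrow> complex^4^4" where
  "F2_S t = F2_Smat (t $ 3) (t $ 4) (t $ 5) (t $ 6)"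

definition F2_z :: "complex^6 \<Rightarrow> complex^2" where
  "F2_z t = vector [t $ 1, t $ 2]"

definition F2_moduli :: "(complex^2) set \<Rightarrow> (complex^4^4) set \<Rightarrow> (complex^6) set" where
  "F2_moduli V0 U0 = {t. F2_z t \<in> V0 \<and> t $ 3 \<noteq> 0 \<and> t $ 6 \<noteq> 0 \<and> F2_S t \<in> U0}"

text \<open>The connection form is \<open>A 1 dz\<^sub>1/z\<^sub>1 + A 2 dz\<^sub>2/z\<^sub>2\<close>.\<close>

definition F2_conn ::
  "(2 \<Rightarrow> complex^2 \<Rightarrow> complex^4^4) \<Rightarrow> complex^6 \<Rightarrow> complex^6 \<Rightarrow> complex^4^4" where
  "F2_conn A t v = scale_mat (v $ 1 / t $ 1) (A 1 (F2_z t)) + scale_mat (v $ 2 / t $ 2) (A 2 (F2_z t))"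

definition F2_modular_mat1 :: "complex \<Rightarrow> complex \<Rightarrow> complex^4^4" where
  "F2_modular_mat1 y1 y2 = vector [
     vector [0, inverse y1, inverse y2, 0],
     vector [0, 0, 0, 0],
     vector [0, 0, 0, 1],
     vector [0, 0, 0, 0]]"

definition F2_modular_mat2 :: "complex \<Rightarrow> complex \<Rightarrow> complex^4^4" where
  "F2_modular_mat2 y3 y4 = vector [
     vector [0, inverse y3, inverse y4, 0],
     vector [0, 0, 0, 1],
     vector [0, 0, 0, 0],
     vector [0, 0, 0, 0]]"

definition F2_gauss_manin ::
  "(2 \<Rightarrow> complex^2 \<Rightarrow> complex^4^4) \<Rightarrow> (complex^2) set \<Rightarrow> (complex^4^4) set \<Rightarrow>
     (complex^6 \<Rightarrow> complex^6) set" where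
  "F2_gauss_manin A V0 U0 =
     (let T = F2_moduli V0 U0; B = frame_change F2_S (F2_conn A) in
      module_span T
        ((\<Union>g\<in>Lie F2_group. fields_with_matrix T B (\<lambda>_. g)) \<union>
         (\<Union>Y1 Y2. fields_with_matrix T B (\<lambda>t. F2_modular_mat1 (Y1 t) (Y2 t))) \<union>
         (\<Union>Y3 Y4. fields_with_matrix T B (\<lambda>t. F2_modular_mat2 (Y3 t) (Y4 t)))))"

end

theory Submission
  imports Defs
begin

text \<open>The fields \<open>R\<^sub>h\<close> and \<open>R\<^sub>f\<close> of the Lie algebra elements \<open>h = diag(-1, 1)\<close> and \<open>f = E\<^sub>2\<^sub>1\<close>
  of the last \<open>2 \<times> 2\<close> block of \<open>S\<close>, together with the modular field \<open>R\<close> (for \<open>F\<^sub>2\<close>: \<open>R\<^sub>1\<close>), form an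
  \<open>sl\<^sub>2\<close>-triple. In coordinates \<open>a\<close>, \<open>b\<close> for the last row of that block, \<open>R\<^sub>h = a \<partial>\<^sub>a + b \<partial>\<^sub>b\<close> and
  \<open>R\<^sub>f = b\<^sup>-\<^sup>1 \<partial>\<^sub>a\<close>, while the coefficients of \<open>R\<close> are explicit in \<open>a\<close>, \<open>b\<close>; the bracket relations
  then follow because the remaining coefficients do not depend on \<open>a\<close> and \<open>b\<close>.\<close>

section \<open>Holomorphic functions and vector fields\<close>

text \<open>The vector is the finite sum of the bounded linear maps \<open>axis i\<close> applied to
  its entries. The entries may lie in any normed space, so two applications handle matrices.\<close>

lemma has_derivative_vecI:
  fixes f :: "'a::real_normed_vector \<Rightarrow> 'b::real_normed_vector^'n"
  assumes "\<And>i. ((\<lambda>x. f x $ i) has_derivative (\<lambda>h. f' h $ i)) F"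
  shows "(f has_derivative f') F"
proof -
  have bl: "bounded_linear (\<lambda>y. axis i y :: 'b^'n)" for i
    by (rule bounded_linear_intro[of _ 1])
       (auto simp: axis_def vec_eq_iff norm_vec_def L2_set_def if_distrib[where f="\<lambda>x. norm x ^ 2"] cong: if_cong)
  have expand: "(\<Sum>i\<in>UNIV. axis i (y $ i)) = y" for y :: "'b^'n"
    by (simp add: vec_eq_iff axis_def)
  have "((\<lambda>x. \<Sum>i\<in>UNIV. axis i (f x $ i) :: 'b^'n) has_derivative
         (\<lambda>h. \<Sum>i\<in>UNIV. axis i (f' h $ i))) F"
    by (intro has_derivative_sum bounded_linear.has_derivative[OF bl] assms)
  thus ?thesis by (simp add: expand)
qed

lemma has_derivative_vec_nth [derivative_intros]:
  "(f has_derivative f') F \<Longrightarrow> ((\<lambda>x. f x $ i) has_derivative (\<lambda>h. f' h $ i)) F"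
  by (rule bounded_linear.has_derivative[OF bounded_linear_vec_nth])

text \<open>A real derivative that commutes with complex scalars is complex linear, so its values on
  the vectors \<open>axis i 1\<close> are the coefficients that \<open>holo_on\<close> asks for.
  Together with \<open>holo_onE\<close> this lets the closure rules follow from the real derivative
  calculus.\<close>

lemma holo_onI:
  fixes f :: "complex^'n \<Rightarrow> complex"
  assumes "\<And>x. x \<in> T \<Longrightarrow> (f has_derivative L x) (at x)"
    and "\<And>x c h. x \<in> T \<Longrightarrow> L x (c *s h) = c * L x h"
  shows "holo_on T f"
  unfolding holo_on_def
proof
  fix x assume x: "x \<in> T"
  interpret bounded_linear "L x" using assms(1)[OF x] by (rule has_derivative_bounded_linear)
  have "L x h = (\<Sum>i\<in>UNIV. (\<chi> i. L x (axis i 1)) $ i * h $ i)" for h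
  proof -
    have "L x h = L x (\<Sum>i\<in>UNIV. (h$i) *s axis i 1)" by (simp add: basis_expansion)
    also have "\<dots> = (\<Sum>i\<in>UNIV. L x ((h$i) *s axis i 1))" by (rule sum)
    finally show ?thesis using assms(2)[OF x] by (simp add: mult.commute)
  qed
  hence "L x = (\<lambda>h. \<Sum>i\<in>UNIV. (\<chi> i. L x (axis i 1)) $ i * h $ i)" by blast
  with assms(1)[OF x]
  show "\<exists>c::complex^'n. (f has_derivative (\<lambda>h. \<Sum>i\<in>UNIV. c $ i * h $ i)) (at x)" by metis
qed

lemma holo_onE:
  fixes f :: "complex^'n \<Rightarrow> complex"
  assumes "holo_on T f"
  obtains L where "\<And>x. x \<in> T \<Longrightarrow> (f has_derivative L x) (at x)"
    and "\<And>x c h. x \<in> T \<Longrightarrow> L x (c *s h) = c * L x h"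
proof -
  from assms obtain C :: "complex^'n \<Rightarrow> complex^'n"
    where C: "\<And>x. x \<in> T \<Longrightarrow> (f has_derivative (\<lambda>h. \<Sum>i\<in>UNIV. C x $ i * h $ i)) (at x)"
    unfolding holo_on_def by metis
  show thesis
    by (rule that[OF C]) (auto simp: sum_distrib_left algebra_simps)
qed

lemma holo_on_const [simp]: "holo_on T (\<lambda>_. c)"
  by (rule holo_onI[where L="\<lambda>_ _. 0"]) auto

lemma holo_on_component [simp]: "holo_on T (\<lambda>x. x $ i)"
  by (rule holo_onI[where L="\<lambda>_ h. h $ i"]) (auto intro!: derivative_eq_intros)

lemma holo_on_add:
  assumes "holo_on T f" "holo_on T g"
  shows "holo_on T (\<lambda>x. f x + g x)"
proof -
  obtain L M where "\<And>x. x \<in> T \<Longrightarrow> (f has_derivative L x) (at x)"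
    "\<And>x c h. x \<in> T \<Longrightarrow> L x (c *s h) = c * L x h"
    "\<And>x. x \<in> T \<Longrightarrow> (g has_derivative M x) (at x)"
    "\<And>x c h. x \<in> T \<Longrightarrow> M x (c *s h) = c * M x h"
    using assms by (metis holo_onE)
  thus ?thesis
    by (intro holo_onI[where L="\<lambda>x h. L x h + M x h"]) (auto intro!: derivative_intros simp: algebra_simps)
qed

lemma holo_on_mult:
  assumes "holo_on T f" "holo_on T g"
  shows "holo_on T (\<lambda>x. f x * g x)"
proof -
  obtain L M where "\<And>x. x \<in> T \<Longrightarrow> (f has_derivative L x) (at x)"
    "\<And>x c h. x \<in> T \<Longrightarrow> L x (c *s h) = c * L x h"
    "\<And>x. x \<in> T \<Longrightarrow> (g has_derivative M x) (at x)"
    "\<And>x c h. x \<in> T \<Longrightarrow> M x (c *s h) = c * M x h"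
    using assms by (metis holo_onE)
  thus ?thesis
    by (intro holo_onI[where L="\<lambda>x h. f x * M x h + L x h * g x"] has_derivative_mult)
       (auto simp: algebra_simps)
qed

lemma holo_on_minus: "holo_on T f \<Longrightarrow> holo_on T (\<lambda>x. - f x)"
  using holo_on_mult[of T "\<lambda>_. -1" f] by simp

lemma holo_on_diff: "holo_on T f \<Longrightarrow> holo_on T g \<Longrightarrow> holo_on T (\<lambda>x. f x - g x)"
  using holo_on_add[of T f "\<lambda>x. - g x"] holo_on_minus[of T g] by simp

lemma holo_on_power: "holo_on T f \<Longrightarrow> holo_on T (\<lambda>x. f x ^ n)"
  by (induction n) (auto intro: holo_on_mult)

lemma holo_on_inverse:
  assumes "holo_on T f" "\<And>x. x \<in> T \<Longrightarrow> f x \<noteq> 0"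
  shows "holo_on T (\<lambda>x. inverse (f x))"
proof -
  obtain L where "\<And>x. x \<in> T \<Longrightarrow> (f has_derivative L x) (at x)"
    "\<And>x c h. x \<in> T \<Longrightarrow> L x (c *s h) = c * L x h"
    using assms by (metis holo_onE)
  thus ?thesis using assms(2)
    by (intro holo_onI[where L="\<lambda>x h. - (inverse (f x) * L x h * inverse (f x))"])
       (auto intro!: derivative_eq_intros simp: algebra_simps)
qed

lemma holo_on_divide:
  "holo_on T f \<Longrightarrow> holo_on T g \<Longrightarrow> (\<And>x. x \<in> T \<Longrightarrow> g x \<noteq> 0) \<Longrightarrow> holo_on T (\<lambda>x. f x / g x)"
  unfolding divide_inverse by (intro holo_on_mult holo_on_inverse)

lemmas holo_on_intros = holo_on_const holo_on_component holo_on_add holo_on_mult holo_on_minus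
  holo_on_diff holo_on_power holo_on_divide

text \<open>Since \<open>T\<close> is open, extension by zero does not change the derivative at
  points of \<open>T\<close>.\<close>

lemma vfields_restrictI:
  assumes "open T" "\<And>i. holo_on T (\<lambda>x. v x $ i)"
  shows "(\<lambda>x. if x \<in> T then v x else 0) \<in> vfields T"
proof -
  have "holo_on T (\<lambda>x. (if x \<in> T then v x else 0) $ i)" for i
    unfolding holo_on_def
  proof
    fix x assume x: "x \<in> T"
    obtain c :: "complex^'a" where "((\<lambda>x. v x $ i) has_derivative (\<lambda>h. \<Sum>i\<in>UNIV. c $ i * h $ i)) (at x)"
      using assms(2)[of i] x unfolding holo_on_def by blast
    hence "((\<lambda>x. (if x \<in> T then v x else 0) $ i) has_derivative (\<lambda>h. \<Sum>i\<in>UNIV. c $ i * h $ i)) (at x)"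
      by (rule has_derivative_transform_within_open[OF _ assms(1) x]) auto
    thus "\<exists>c::complex^'a. ((\<lambda>x. (if x \<in> T then v x else 0) $ i) has_derivative
            (\<lambda>h. \<Sum>i\<in>UNIV. c $ i * h $ i)) (at x)" by blast
  qed
  thus ?thesis unfolding vfields_def by auto
qed

text \<open>A priori the derivative is only real linear; holomorphy of the components makes it
  complex linear, and bilinearity of \<open>vbracket\<close> over the complex numbers rests on
  this.\<close>

lemma vfields_frechet:
  assumes "v \<in> vfields T" "x \<in> T"
  shows "(v has_derivative frechet_derivative v (at x)) (at x)"
    and "frechet_derivative v (at x) (c *s h) = c *s frechet_derivative v (at x) h"
proof -
  have "\<forall>i. \<exists>L. ((\<lambda>x. v x $ i) has_derivative L) (at x) \<and> (\<forall>c h. L (c *s h) = c * L h)"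
    using assms unfolding vfields_def by (metis (mono_tags, lifting) holo_onE mem_Collect_eq)
  then obtain L where L: "\<And>i. ((\<lambda>x. v x $ i) has_derivative L i) (at x)"
      "\<And>i c h. L i (c *s h) = c * L i h" by metis
  have D: "(v has_derivative (\<lambda>h. \<chi> i. L i h)) (at x)"
    by (rule has_derivative_vecI) (simp add: L)
  note eq = frechet_derivative_at[OF D]
  show "(v has_derivative frechet_derivative v (at x)) (at x)" using D eq by simp
  show "frechet_derivative v (at x) (c *s h) = c *s frechet_derivative v (at x) h"
    by (simp add: eq[symmetric] L(2) vec_eq_iff)
qed

lemma frechet_derivative_lin3:
  assumes "r \<in> vfields T" "x \<in> T"
  shows "frechet_derivative r (at x) (a *s u + b *s v + c *s w) =
    a *s frechet_derivative r (at x) u + b *s frechet_derivative r (at x) v +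
    c *s frechet_derivative r (at x) w"
proof -
  interpret bounded_linear "frechet_derivative r (at x)"
    using vfields_frechet(1)[OF assms] by (rule has_derivative_bounded_linear)
  show ?thesis unfolding add vfields_frechet(2)[OF assms] ..
qed

lemma frechet_derivative_comb3:
  assumes "u \<in> vfields T" "v \<in> vfields T" "w \<in> vfields T" "x \<in> T"
  shows "frechet_derivative (\<lambda>x. a *s u x + b *s v x + c *s w x) (at x) h =
    a *s frechet_derivative u (at x) h + b *s frechet_derivative v (at x) h +
    c *s frechet_derivative w (at x) h"
proof -
  have scale: "((\<lambda>x. a *s r x) has_derivative (\<lambda>h. a *s frechet_derivative r (at x) h)) (at x)"
    if "r \<in> vfields T" for r and a :: complex
    by (rule has_derivative_vecI, unfold vector_smult_component,
        rule has_derivative_mult_right, rule has_derivative_vec_nth,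
        rule vfields_frechet(1)[OF that assms(4)])
  show ?thesis
    by (rule frechet_derivative_at[symmetric, THEN fun_cong, OF
        has_derivative_add[OF has_derivative_add[OF scale[OF assms(1)] scale[OF assms(2)]]
          scale[OF assms(3)]]])
qed

text \<open>Along the line through \<open>x\<close> in direction \<open>d\<close> the function is
  constant, while the chain rule expresses its derivative there by \<open>L\<close>; derivatives are
  unique.\<close>

lemma has_derivative_constant_direction:
  fixes g :: "'a::real_normed_vector \<Rightarrow> 'b::real_normed_vector"
  assumes g: "(g has_derivative L) (at x)" and c: "\<And>t::real. g (x + t *\<^sub>R d) = g x"
  shows "L d = 0"
proof -
  have "((\<lambda>t. g (x + t *\<^sub>R d)) has_derivative (\<lambda>t. L (t *\<^sub>R d))) (at 0)"
  proof -
    have "((\<lambda>t::real. x + t *\<^sub>R d) has_derivative (\<lambda>t. t *\<^sub>R d)) (at 0)"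
      by (auto intro!: derivative_eq_intros)
    from diff_chain_at[OF this, of g L] g show ?thesis by (simp add: o_def)
  qed
  moreover have "((\<lambda>t. g (x + t *\<^sub>R d)) has_derivative (\<lambda>t::real. 0)) (at 0)"
    unfolding c by simp
  ultimately have "(\<lambda>t::real. L (t *\<^sub>R d)) = (\<lambda>t. 0)" by (rule has_derivative_unique)
  from fun_cong[OF this, of 1] show ?thesis by simp
qed


section \<open>Copies of \<open>sl\<^sub>2\<close> spanned by triples of vector fields\<close>

text \<open>The basis diag(1, -1), E12, E21 of \<open>sl2\<close> is sent to \<open>h\<close>,
  \<open>e\<close>, \<open>f\<close>; by bilinearity three bracket relations determine all brackets.
  Independence of the values at the single point \<open>x0\<close> already makes this map
  injective.\<close>

lemma sl2_triple:
  fixes e h f :: "complex^'n \<Rightarrow> complex^'n"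
  assumes V: "e \<in> vfields T" "h \<in> vfields T" "f \<in> vfields T"
    and X: "e \<in> X" "h \<in> X" "f \<in> X"
    and he: "\<And>x. x \<in> T \<Longrightarrow> vbracket T h e x = 2 *s e x"
    and hf: "\<And>x. x \<in> T \<Longrightarrow> vbracket T h f x = (-2) *s f x"
    and ef: "\<And>x. x \<in> T \<Longrightarrow> vbracket T e f x = h x"
    and indep: "\<And>a b c. a *s h x0 + b *s e x0 + c *s f x0 = 0 \<Longrightarrow> a = 0 \<and> b = 0 \<and> c = 0"
  shows "\<exists>L. lie_subalgebra T L (module_span T X) \<and> isomorphic_sl2 T L"
proof -
  define \<phi> where "\<phi> = (\<lambda>M::complex^2^2. \<lambda>x. M$1$1 *s h x + M$1$2 *s e x + M$2$1 *s f x)"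
  have out: "e x = 0" "h x = 0" "f x = 0" if "x \<notin> T" for x
    using V that unfolding vfields_def by auto
  have sl2_iff: "M \<in> sl2 \<longleftrightarrow> M$2$2 = - M$1$1" for M :: "complex^2^2"
    unfolding sl2_def trace_def by (auto simp: sum_2 add_eq_0_iff2 add.commute)
  have add: "\<phi> (M + N) = (\<lambda>x. \<phi> M x + \<phi> N x)" for M N
    unfolding \<phi>_def by (auto simp: vec_eq_iff algebra_simps)
  have scale: "\<phi> (scale_mat a M) = (\<lambda>x. a *s \<phi> M x)" for a M
    unfolding \<phi>_def scale_mat_def by (auto simp: vec_eq_iff algebra_simps)
  have br: "\<phi> (M ** N - N ** M) = vbracket T (\<phi> M) (\<phi> N)" if MN: "M \<in> sl2" "N \<in> sl2" for M N
  proof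
    fix x
    show "\<phi> (M ** N - N ** M) x = vbracket T (\<phi> M) (\<phi> N) x"
    proof (cases "x \<in> T")
      case False
      then show ?thesis by (simp add: vbracket_def \<phi>_def out)
    next
      case x: True
      define De where "De = frechet_derivative e (at x)"
      define Dh where "Dh = frechet_derivative h (at x)"
      define Df where "Df = frechet_derivative f (at x)"
      have D: "frechet_derivative (\<phi> M) (at x) y = M$1$1 *s Dh y + M$1$2 *s De y + M$2$1 *s Df y"
        for M y
        unfolding \<phi>_def De_def Dh_def Df_def
        by (rule frechet_derivative_comb3[OF V(2,1,3) x])
      have lin: "De (a *s u + b *s v + c *s w) = a *s De u + b *s De v + c *s De w"
         "Dh (a *s u + b *s v + c *s w) = a *s Dh u + b *s Dh v + c *s Dh w"
         "Df (a *s u + b *s v + c *s w) = a *s Df u + b *s Df v + c *s Df w" for a b c u v w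
        unfolding De_def Dh_def Df_def
        by (rule frechet_derivative_lin3[OF _ x], rule V)+
      \<comment> \<open>Each relation is solved for one of its two mixed derivatives. After
        expansion the other mixed derivatives cancel and only multiples of \<open>e\<close>,
        \<open>h\<close>, \<open>f\<close> remain.\<close>
      have 1: "De (h x) $ i = Dh (e x) $ i + 2 * e x $ i" for i
        using arg_cong[where f="\<lambda>v. v $ i", OF he[OF x]] x
        by (simp add: vbracket_def De_def Dh_def algebra_simps)
      have 2: "Df (h x) $ i = Dh (f x) $ i - 2 * f x $ i" for i
        using arg_cong[where f="\<lambda>v. v $ i", OF hf[OF x]] x
        by (simp add: vbracket_def Df_def Dh_def algebra_simps)
      have 3: "Df (e x) $ i = De (f x) $ i + h x $ i" for i
        using arg_cong[where f="\<lambda>v. v $ i", OF ef[OF x]] x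
        by (simp add: vbracket_def Df_def De_def algebra_simps)
      have "\<phi> (M ** N - N ** M) x $ i = vbracket T (\<phi> M) (\<phi> N) x $ i" for i
      proof -
        have "vbracket T (\<phi> M) (\<phi> N) x $ i =
          (N$1$1 *s Dh (\<phi> M x) + N$1$2 *s De (\<phi> M x) + N$2$1 *s Df (\<phi> M x)
          - (M$1$1 *s Dh (\<phi> N x) + M$1$2 *s De (\<phi> N x) + M$2$1 *s Df (\<phi> N x))) $ i"
          using x by (simp add: vbracket_def D)
        also have "\<dots> = \<phi> (M ** N - N ** M) x $ i"
          using MN unfolding \<phi>_def lin by (simp add: 1 2 3 matrix_matrix_mult_def sum_2 sl2_iff algebra_simps)
        finally show ?thesis by simp
      qed
      thus ?thesis by (simp add: vec_eq_iff)
    qed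
  qed
  define L where "L = \<phi> ` sl2"
  have inj: "inj_on \<phi> sl2"
  proof (rule inj_onI)
    fix M N assume MN: "M \<in> sl2" "N \<in> sl2" "\<phi> M = \<phi> N"
    have "(M$1$1 - N$1$1) *s h x0 + (M$1$2 - N$1$2) *s e x0 + (M$2$1 - N$2$1) *s f x0 = 0"
      using fun_cong[OF MN(3), of x0] unfolding \<phi>_def by (simp add: vec_eq_iff algebra_simps)
    from indep[OF this] show "M = N"
      using MN(1,2) by (simp add: vec_eq_iff forall_2 sl2_iff)
  qed
  have bij: "bij_betw \<phi> sl2 L" using inj unfolding L_def bij_betw_def by simp
  have closed: "M + N \<in> sl2" "scale_mat a M \<in> sl2" "M ** N - N ** M \<in> sl2"
    if "M \<in> sl2" "N \<in> sl2" for M N a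
    using that by (auto simp: sl2_iff scale_mat_def matrix_matrix_mult_def sum_2)
  have zero: "(\<lambda>x. 0) \<in> L"
    unfolding L_def \<phi>_def by (rule image_eqI[of _ _ 0]) (auto simp: sl2_iff vec_eq_iff)
  \<comment> \<open>The span is a sum over the set \<open>{e, h, f}\<close>, where equal fields
    would merge into one term.\<close>
  have ne: "e \<noteq> h" "e \<noteq> f" "h \<noteq> f"
    using indep[of "-1" 1 0] indep[of 0 "-1" 1] indep[of "-1" 0 1]
    by (auto simp: vec_eq_iff)
  have span: "L \<subseteq> module_span T X"
  proof
    fix v assume "v \<in> L"
    then obtain M where v: "v = \<phi> M" unfolding L_def by blast
    define c where "c = (\<lambda>r. \<lambda>_::complex^'n. if r = e then M$1$2 else if r = h then M$1$1 else M$2$1)"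
    have "v = (\<lambda>x. \<Sum>r\<in>{e,h,f}. c r x *s r x)"
      using ne unfolding v \<phi>_def c_def by (auto simp: fun_eq_iff vec_eq_iff)
    thus "v \<in> module_span T X"
      unfolding module_span_def using X
      by (intro CollectI exI[of _ "{e,h,f}"] exI[of _ c]) (auto simp: c_def)
  qed
  have "lie_subalgebra T L (module_span T X)"
    unfolding lie_subalgebra_def
    using span zero closed add[symmetric] scale[symmetric] br[symmetric] unfolding L_def by auto
  moreover have "isomorphic_sl2 T L"
    unfolding isomorphic_sl2_def using bij add scale br by blast
  ultimately show ?thesis by blast
qed

text \<open>The shape shared by both families: \<open>x $ p\<close> and \<open>x $ q\<close> are the entries of the last row of
  the lower right block of \<open>S\<close>, and \<open>e\<close> is graded of weight 2 for their Euler field \<open>h\<close>.\<close>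

lemma sl2_triple_normal_form:
  fixes G :: "'n::finite \<Rightarrow> complex^'n \<Rightarrow> complex" and p q k :: 'n
  defines "e0 \<equiv> \<lambda>x. \<chi> i. if i = p then - (x$p) * (x$q)^2 * G q x - (x$q)^3 * G p x
       else if i = q then (x$q)^3 * G q x - x$p * (x$q)^2 else (x$q)^2 * G i x"
    and "h0 \<equiv> \<lambda>x. \<chi> i. if i = p then x$p else if i = q then x$q else 0"
    and "f0 \<equiv> \<lambda>x. \<chi> i. if i = p then 1 / x$q else 0"
  assumes pq: "p \<noteq> q" and T: "open T" and nz: "\<And>x. x \<in> T \<Longrightarrow> x $ q \<noteq> 0"
    and holo: "\<And>i. holo_on T (G i)"
    and dep: "\<And>i x y. (\<And>j. j \<noteq> p \<Longrightarrow> j \<noteq> q \<Longrightarrow> x $ j = y $ j) \<Longrightarrow> G i x = G i y"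
    and x0: "x0 \<in> T" "k \<noteq> p" "k \<noteq> q" "G k x0 \<noteq> 0"
    and X: "(\<lambda>x. if x \<in> T then e0 x else 0) \<in> vfields T \<Longrightarrow> (\<lambda>x. if x \<in> T then e0 x else 0) \<in> X"
      "(\<lambda>x. if x \<in> T then h0 x else 0) \<in> vfields T \<Longrightarrow> (\<lambda>x. if x \<in> T then h0 x else 0) \<in> X"
      "(\<lambda>x. if x \<in> T then f0 x else 0) \<in> vfields T \<Longrightarrow> (\<lambda>x. if x \<in> T then f0 x else 0) \<in> X"
  shows "\<exists>L. lie_subalgebra T L (module_span T X) \<and> isomorphic_sl2 T L"
proof -
  let ?e = "\<lambda>x. if x \<in> T then e0 x else 0"
  let ?h = "\<lambda>x. if x \<in> T then h0 x else 0"
  let ?f = "\<lambda>x. if x \<in> T then f0 x else 0"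
  have holo': "holo_on T (\<lambda>x. if b then g x else g' x)" if "holo_on T g" "holo_on T g'"
    for b and g g' :: "complex^'n \<Rightarrow> complex" using that by (cases b) simp_all
  have ve: "?e \<in> vfields T"
    by (rule vfields_restrictI[OF T]) (auto simp: e0_def intro!: holo' holo_on_intros holo)
  have vh: "?h \<in> vfields T"
    by (rule vfields_restrictI[OF T]) (auto simp: h0_def intro!: holo' holo_on_intros)
  have vf: "?f \<in> vfields T"
    by (rule vfields_restrictI[OF T]) (auto simp: f0_def intro!: holo' holo_on_intros nz)
  have bracket: "vbracket T (\<lambda>x. if x \<in> T then v x else 0) (\<lambda>x. if x \<in> T then w x else 0) x =
      Dw (v x) - Dv (w x)" if "x \<in> T" "(v has_derivative Dv) (at x)" "(w has_derivative Dw) (at x)"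
      for v w Dv Dw x
  proof -
    have "((\<lambda>x. if x \<in> T then v x else 0) has_derivative Dv) (at x)"
         "((\<lambda>x. if x \<in> T then w x else 0) has_derivative Dw) (at x)"
      by (rule has_derivative_transform_within_open[OF that(2) T that(1)]; simp)
         (rule has_derivative_transform_within_open[OF that(3) T that(1)]; simp)
    from this[THEN frechet_derivative_at] show ?thesis using that(1) by (simp add: vbracket_def)
  qed
  define L where "L = (\<lambda>i x. frechet_derivative (G i) (at x))"
  have L: "(G i has_derivative L i x) (at x)" if "x \<in> T" for i x
    using holo[of i] that frechet_derivative_works unfolding holo_on_def L_def differentiable_def
    by blast
  \<comment> \<open>To be applied to \<open>h0\<close> and \<open>f0\<close>, which have entries
    only in positions \<open>p\<close> and \<open>q\<close>, on which no \<open>G i\<close>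
    depends.\<close>
  have L0: "L i x d = 0" if "x \<in> T" "\<And>j. j \<noteq> p \<Longrightarrow> j \<noteq> q \<Longrightarrow> d $ j = 0" for i x d
    by (rule has_derivative_constant_direction[OF L[OF that(1)]]) (rule dep, simp add: that(2))
  define De where "De = (\<lambda>x d. \<chi> i.
      if i = p then - (d$p * (x$q)^2 * G q x + x$p * (2 * x$q * d$q) * G q x + x$p * (x$q)^2 * L q x d)
          - (3 * (x$q)^2 * d$q * G p x + (x$q)^3 * L p x d)
      else if i = q then 3 * (x$q)^2 * d$q * G q x + (x$q)^3 * L q x d - (d$p * (x$q)^2 + x$p * (2 * x$q * d$q))
      else 2 * x$q * d$q * G i x + (x$q)^2 * L i x d)"
  have De: "(e0 has_derivative De x) (at x)" if "x \<in> T" for x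
  proof (rule has_derivative_vecI)
    fix i
    note L' = L[OF that, of p] L[OF that, of q] L[OF that, of i]
    have "((\<lambda>x. - (x$p) * (x$q)^2 * G q x - (x$q)^3 * G p x) has_derivative
        (\<lambda>d. - (d$p * (x$q)^2 * G q x + x$p * (2 * x$q * d$q) * G q x + x$p * (x$q)^2 * L q x d)
          - (3 * (x$q)^2 * d$q * G p x + (x$q)^3 * L p x d))) (at x)"
      by (rule L'[THEN has_derivative_eq_rhs] derivative_eq_intros refl)+
         (auto simp: fun_eq_iff algebra_simps power2_eq_square power3_eq_cube)
    moreover have "((\<lambda>x. (x$q)^3 * G q x - x$p * (x$q)^2) has_derivative
        (\<lambda>d. 3 * (x$q)^2 * d$q * G q x + (x$q)^3 * L q x d
          - (d$p * (x$q)^2 + x$p * (2 * x$q * d$q)))) (at x)"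
      by (rule L'[THEN has_derivative_eq_rhs] derivative_eq_intros refl)+
         (auto simp: fun_eq_iff algebra_simps power2_eq_square power3_eq_cube)
    moreover have "((\<lambda>x. (x$q)^2 * G i x) has_derivative
        (\<lambda>d. 2 * x$q * d$q * G i x + (x$q)^2 * L i x d)) (at x)"
      by (rule L'[THEN has_derivative_eq_rhs] derivative_eq_intros refl)+
         (auto simp: fun_eq_iff algebra_simps power2_eq_square power3_eq_cube)
    ultimately show "((\<lambda>x. e0 x $ i) has_derivative (\<lambda>h. De x h $ i)) (at x)"
      unfolding e0_def De_def by (cases "i = p"; cases "i = q") simp_all
  qed
  define Dh where "Dh = (\<lambda>d::complex^'n. \<chi> i. if i = p then d$p else if i = q then d$q else 0)"
  have Dh: "(h0 has_derivative Dh) (at x)" for x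
  proof (rule has_derivative_vecI)
    show "((\<lambda>x. h0 x $ i) has_derivative (\<lambda>d. Dh d $ i)) (at x)" for i
      unfolding h0_def Dh_def
      by (cases "i = p"; cases "i = q") (simp_all, (intro derivative_intros has_derivative_ident)+)
  qed
  define Df where "Df = (\<lambda>x d::complex^'n. \<chi> i. if i = p then - d$q / (x$q)^2 else 0)"
  have Df: "(f0 has_derivative Df x) (at x)" if "x \<in> T" for x
  proof (rule has_derivative_vecI)
    show "((\<lambda>x. f0 x $ i) has_derivative (\<lambda>d. Df x d $ i)) (at x)" for i
    proof (cases "i = p")
      case True
      have "((\<lambda>x. 1 / x $ q) has_derivative (\<lambda>d. - d$q / (x$q)^2)) (at x)"
        by (rule derivative_eq_intros refl)+
           (auto simp: nz[OF that] power2_eq_square divide_inverse)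
      with True show ?thesis by (simp add: f0_def Df_def)
    qed (simp add: f0_def Df_def)
  qed
  note fields = e0_def h0_def f0_def De_def Dh_def Df_def
  show ?thesis
  proof (rule sl2_triple[OF ve vh vf X(1)[OF ve] X(2)[OF vh] X(3)[OF vf], where ?x0.0=x0])
    fix x assume x: "x \<in> T"
    have Lh: "L i x (h0 x) = 0" and Lf: "L i x (f0 x) = 0" for i
      by (auto intro!: L0 x simp: h0_def f0_def)
    have h: "?h x = h0 x" and e: "?e x = e0 x" and f: "?f x = f0 x" using x by simp_all
    \<comment> \<open>Homogeneity in the pair \<open>x$p\<close>, \<open>x$q\<close>: the entries
      \<open>p\<close>, \<open>q\<close> of \<open>e0\<close> have degree 3 and the others degree 2,
      so the Euler field gives factors 3 and 2. Subtracting \<open>Dh (e0 x)\<close> lowers only the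
      entries \<open>p\<close>, \<open>q\<close> by 1, leaving the factor 2 throughout.\<close>
    have "(De x (h0 x) - Dh (e0 x)) $ i = 2 * e0 x $ i" for i
      unfolding De_def Lh Dh_def unfolding e0_def h0_def using pq
      by (cases "i = p"; cases "i = q") (simp_all add: algebra_simps power2_eq_square power3_eq_cube)
    thus "vbracket T ?h ?e x = 2 *s ?e x"
      unfolding bracket[OF x Dh De[OF x]] e by (simp add: vec_eq_iff)
    \<comment> \<open>The entry of \<open>f0\<close> has degree -1, and \<open>Dh\<close>
      contributes a further -1.\<close>
    have "(Df x (h0 x) - Dh (f0 x)) $ i = - 2 * f0 x $ i" for i
      unfolding Df_def Dh_def f0_def h0_def using pq nz[OF x]
      by (cases "i = p"; cases "i = q") (simp_all add: power2_eq_square)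
    thus "vbracket T ?h ?f x = (-2) *s ?f x"
      unfolding bracket[OF x Dh Df[OF x]] f by (simp add: vec_eq_iff)
    \<comment> \<open>The terms with \<open>G q\<close> cancel; what survives comes from the summand
      \<open>- x$p * (x$q)^2\<close> in entry \<open>q\<close> of \<open>e0\<close>, the only one
      that does not involve \<open>G\<close>.\<close>
    have "(Df x (e0 x) - De x (f0 x)) $ i = h0 x $ i" for i
      unfolding De_def Lf Df_def unfolding f0_def h0_def e0_def using pq nz[OF x]
      by (cases "i = p"; cases "i = q") (simp_all add: field_simps power2_eq_square power3_eq_cube)
    thus "vbracket T ?e ?f x = ?h x"
      unfolding bracket[OF x De[OF x] Df[OF x]] h by (simp add: vec_eq_iff)
  next
    fix a b c assume eq: "a *s ?h x0 + b *s ?e x0 + c *s ?f x0 = 0"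
    note comp = arg_cong[OF eq, of "\<lambda>v. v $ i" for i]
    \<comment> \<open>The system is triangular: only \<open>e\<close> has an entry at
      \<open>k\<close>, then only \<open>h\<close> is left at \<open>q\<close>, then only
      \<open>f\<close> at \<open>p\<close>.\<close>
    have b: "b = 0" using comp[of k] x0 nz[OF x0(1)] by (simp add: fields)
    moreover have a: "a = 0" using comp[of q] x0 nz[OF x0(1)] pq b by (simp add: fields)
    moreover have "c = 0" using comp[of p] x0 nz[OF x0(1)] pq a b by (simp add: fields)
    ultimately show "a = 0 \<and> b = 0 \<and> c = 0" by blast
  qed
qed


section \<open>The connection in a moving frame\<close>

text \<open>Multiplying by \<open>S x\<close> on the right removes the inverse, so that a connection
  matrix can be checked without computing \<open>matrix_inv\<close>.\<close>

lemma frame_change_eqI: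
  assumes "(S has_derivative D) (at x)" "invertible (S x)"
    and "D v + S x ** A x v = M ** S x"
  shows "frame_change S A x v = M"
proof -
  have "frechet_derivative S (at x) = D" using frechet_derivative_at[OF assms(1)] by simp
  hence "frame_change S A x v = M ** S x ** matrix_inv (S x)"
    using assms(3) by (simp add: frame_change_def)
  also have "\<dots> = M ** (S x ** matrix_inv (S x))" by (rule matrix_mul_assoc[symmetric])
  also have "S x ** matrix_inv (S x) = mat 1"
    using assms(2) unfolding invertible_def matrix_inv_def by (metis (mono_tags, lifting) someI_ex)
  finally show ?thesis by simp
qed

lemma fields_with_matrix_restrictI:
  assumes "(\<lambda>x. if x \<in> T then v x else 0) \<in> vfields T"
    and "\<And>x. x \<in> T \<Longrightarrow> B x (v x) = M x"
  shows "(\<lambda>x. if x \<in> T then v x else 0) \<in> fields_with_matrix T B M"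
  using assms unfolding fields_with_matrix_def by simp

text \<open>\<open>U0\<close> is open only relative to the matrix group, so an ambient open set
  cutting it out is pulled back instead.\<close>

lemma open_preimage_openin:
  assumes "openin (top_of_set G) U" "open T" "continuous_on T S" "S ` T \<subseteq> G"
  shows "open {t \<in> T. S t \<in> U}"
proof -
  obtain W where W: "open W" "U = G \<inter> W" using assms(1) by (auto simp: openin_open)
  have "{t \<in> T. S t \<in> U} = T \<inter> S -` W" using W(2) assms(4) by auto
  thus ?thesis using continuous_open_preimage[OF assms(3,2) W(1)] by simp
qed


section \<open>The mirror of local \<open>P\<^sup>2\<close>\<close>

lemma P2_S_has_derivative:
  assumes "x $ 3 \<noteq> 0"
  shows "(P2_S has_derivative (\<lambda>v. vector [0, vector [0, - v$3 / (x$3)^2, 0], vector [0, v$2, v$3]])) (at x)"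
proof (rule has_derivative_vecI, rule has_derivative_vecI)
  fix i j
  have inv: "((\<lambda>x. inverse (x $ 3)) has_derivative (\<lambda>v. - v$3 / (x$3)^2)) (at x)"
    using assms by (auto intro!: derivative_eq_intros simp: power2_eq_square field_simps)
  have "\<forall>i j. ((\<lambda>x. P2_S x $ i $ j) has_derivative
      (\<lambda>v. (vector [0, vector [0, - v$3 / (x$3)^2, 0], vector [0, v$2, v$3]] :: complex^3^3) $ i $ j)) (at x)"
    unfolding forall_3 P2_S_def P2_Smat_def vector_3 zero_index
    by (intro conjI inv has_derivative_const has_derivative_vec_nth has_derivative_ident)
  thus "((\<lambda>x. P2_S x $ i $ j) has_derivative
      (\<lambda>v. (vector [0, vector [0, - v$3 / (x$3)^2, 0], vector [0, v$2, v$3]] :: complex^3^3) $ i $ j)) (at x)"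
    by blast
qed

lemma P2_Smat_right_inverse:
  "b \<noteq> 0 \<Longrightarrow> P2_Smat a b ** P2_Smat (- a) (inverse b) = mat 1"
  by (simp add: vec_eq_iff matrix_matrix_mult_def forall_3 sum_3 P2_Smat_def mat_def)

lemma invertible_P2_S: "x $ 3 \<noteq> 0 \<Longrightarrow> invertible (P2_S x)"
  unfolding P2_S_def invertible_right_inverse using P2_Smat_right_inverse by blast

lemma open_P2_moduli:
  assumes "open V0" "openin (top_of_set P2_group) U0"
  shows "open (P2_moduli V0 U0)"
proof -
  let ?T = "{t::complex^3. t $ 1 \<in> V0 \<and> t $ 3 \<noteq> 0}"
  have "?T = ((\<lambda>t. t $ 1) -` V0) \<inter> ((\<lambda>t. t $ 3) -` (- {0}))" by auto
  hence T: "open ?T"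
    by (auto intro!: open_Int open_vimage assms continuous_intros)
  have "continuous_on ?T P2_S"
    using has_derivative_continuous[OF P2_S_has_derivative]
    by (intro continuous_at_imp_continuous_on) blast
  moreover have "P2_S ` ?T \<subseteq> P2_group" unfolding P2_S_def P2_group_def by auto
  ultimately show ?thesis
    using open_preimage_openin[OF assms(2) T] unfolding P2_moduli_def by (simp add: conj_assoc)
qed

text \<open>Tangent to the curve s33 = 1 + t, s32 = 0. The corresponding field is the Euler field of
  s32, s33.\<close>

lemma P2_Lie_torus: "vector [0, vector [0, -1, 0], vector [0, 0, 1]] \<in> Lie P2_group"
  unfolding Lie_def mem_Collect_eq
proof (intro exI[of _ "\<lambda>t. P2_Smat 0 (1 + t)"] conjI)
  show "P2_Smat 0 (1 + 0) = mat 1"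
    by (simp add: vec_eq_iff forall_3 P2_Smat_def mat_def)
  \<comment> \<open>At t = -1, and only there, the curve leaves the group.\<close>
  have "\<forall>\<^sub>F t in nhds 0. t \<noteq> (- 1 :: complex)" by (rule t1_space_nhds) simp
  thus "\<forall>\<^sub>F t in nhds 0. P2_Smat 0 (1 + t) \<in> P2_group"
    unfolding P2_group_def
    by eventually_elim (intro CollectI exI[of _ 0] exI[of _ "1 + _"], simp add: add_eq_0_iff)
  show "\<forall>i j. ((\<lambda>t. P2_Smat 0 (1 + t) $ i $ j) has_field_derivative
      (vector [0, vector [0, -1, 0], vector [0, 0, 1]] :: complex^3^3) $ i $ j) (at 0)"
    unfolding forall_3 P2_Smat_def by (auto intro!: derivative_eq_intros)
qed

lemma P2_Lie_lower: "vector [0, 0, vector [0, 1, 0]] \<in> Lie P2_group"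
  unfolding Lie_def mem_Collect_eq
proof (intro exI[of _ "\<lambda>t. P2_Smat t 1"] conjI)
  show "P2_Smat 0 1 = mat 1"
    by (simp add: vec_eq_iff forall_3 P2_Smat_def mat_def)
  show "\<forall>\<^sub>F t in nhds 0. P2_Smat t 1 \<in> P2_group"
    unfolding P2_group_def
    by (intro always_eventually allI CollectI exI[of _ 1] exI) simp
  show "\<forall>i j. ((\<lambda>t. P2_Smat t 1 $ i $ j) has_field_derivative
      (vector [0, 0, vector [0, 1, 0]] :: complex^3^3) $ i $ j) (at 0)"
    unfolding forall_3 P2_Smat_def by (auto intro!: derivative_eq_intros)
qed

lemma P2_sl2:
  assumes V0: "open V0" "V0 \<noteq> {}" "V0 \<subseteq> P2_base"
    and U0: "openin (top_of_set P2_group) U0" "mat 1 \<in> U0"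
  shows "\<exists>L. lie_subalgebra (P2_moduli V0 U0) L (P2_gauss_manin V0 U0) \<and>
             isomorphic_sl2 (P2_moduli V0 U0) L"
proof -
  define T where "T = P2_moduli V0 U0"
  let ?B = "frame_change P2_S P2_conn"
  \<comment> \<open>Entry (2, 3) of the equation for \<open>R\<close> forces the component of
    \<open>R\<close> along \<theta> to be s33^2 / Y111 = -3 (1 - 27 z) s33^2, which gives
    \<open>G 1\<close>. Entry (3, 2) then makes the s32-component 18 z s33 times this, which gives
    \<open>G 2\<close>.\<close>
  define G where "G = (\<lambda>(i::3) (x::complex^3). if i = 1 then - 3 * x$1 * (1 - 27 * x$1)
      else if i = 2 then 54 * x$1 * (1 - 27 * x$1) else 0)"
  obtain z0 where z0: "z0 \<in> V0" using V0(2) by blast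
  have base: "x$1 \<noteq> 0" "1 - 27 * x$1 \<noteq> 0" "x$3 \<noteq> 0" if "x \<in> T" for x
    using that V0(3) unfolding T_def P2_moduli_def P2_base_def by auto
  have frame: "?B x v = M" if x: "x \<in> T"
      and eq: "vector [0, vector [0, - v$3 / (x$3)^2, 0], vector [0, v$2, v$3]] + P2_S x ** P2_conn x v
        = M ** P2_S x" for x v M
    by (rule frame_change_eqI[OF P2_S_has_derivative invertible_P2_S]) (use base[OF x] eq in simp_all)
  note mat_simps = vec_eq_iff matrix_matrix_mult_def forall_3 sum_3 P2_S_def P2_Smat_def P2_conn_def
    scale_mat_def P2_theta_mat_def
  show ?thesis unfolding P2_gauss_manin_def Let_def T_def[symmetric]
  \<comment> \<open>Positions 2 and 3 hold s32 and s33, and \<open>G 1\<close> vanishes nowhere on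
    the base. The point \<open>x0\<close> lies over \<open>z0\<close> with \<open>S\<close> the
    identity.\<close>
  proof (rule sl2_triple_normal_form[where p=2 and q=3 and k=1 and G=G and ?x0.0="vector [z0, 0, 1]"])
    show "open T" unfolding T_def by (rule open_P2_moduli[OF V0(1) U0(1)])
    show "x $ 3 \<noteq> 0" if "x \<in> T" for x using base that by blast
    show "holo_on T (G i)" for i
      unfolding G_def by (cases "i = 1"; cases "i = 2") (auto intro!: holo_on_intros)
    show "G i x = G i y" if "\<And>j. j \<noteq> 2 \<Longrightarrow> j \<noteq> 3 \<Longrightarrow> x $ j = y $ j" for i x y
      using that[of 1] by (simp add: G_def)
    have "P2_S (vector [z0, 0, 1]) = mat 1"
      by (simp add: vec_eq_iff forall_3 P2_S_def P2_Smat_def mat_def)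
    thus x0: "vector [z0, 0, 1] \<in> T" using z0 U0(2) by (simp add: T_def P2_moduli_def)
    show "G 1 (vector [z0, 0, 1]) \<noteq> 0" using base[OF x0] by (simp add: G_def)
  next
    let ?v = "\<lambda>x::complex^3. \<chi> i::3. if i = 2 then - x$2 * (x$3)\<^sup>2 * G 3 x - x$3^3 * G 2 x
        else if i = 3 then x$3^3 * G 3 x - x$2 * (x$3)\<^sup>2 else (x$3)\<^sup>2 * G i x"
    assume v: "(\<lambda>x. if x \<in> T then ?v x else 0) \<in> vfields T"
    \<comment> \<open>Read off from entry (1, 2): 1/Y is s33 times the component along
      \<theta>.\<close>
    define Y where "Y = (\<lambda>x::complex^3. inverse (- 3 * (1 - 27 * x$1) * x$3^3))"
    have "(\<lambda>x. if x \<in> T then ?v x else 0) \<in> fields_with_matrix T ?B (\<lambda>t. P2_modular_mat (Y t))"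
    proof (rule fields_with_matrix_restrictI[OF v], rule frame)
      fix x assume "x \<in> T"
      from base[OF this]
      show "vector [0, vector [0, - ?v x$3 / (x$3)^2, 0], vector [0, ?v x$2, ?v x$3]] + P2_S x ** P2_conn x (?v x)
        = P2_modular_mat (Y x) ** P2_S x"
        by (simp add: mat_simps P2_modular_mat_def P2_Y111_def G_def Y_def)
           (simp add: field_simps power2_eq_square power3_eq_cube)
    qed
    thus "(\<lambda>x. if x \<in> T then ?v x else 0) \<in>
        (\<Union>g\<in>Lie P2_group. fields_with_matrix T ?B (\<lambda>_. g)) \<union>
         (\<Union>Y. fields_with_matrix T ?B (\<lambda>t. P2_modular_mat (Y t)))" by blast
  next
    let ?v = "\<lambda>x::complex^3. \<chi> i::3. if i = 2 then x$2 else if i = 3 then x$3 else 0"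
    assume v: "(\<lambda>x. if x \<in> T then ?v x else 0) \<in> vfields T"
    have "(\<lambda>x. if x \<in> T then ?v x else 0) \<in>
      fields_with_matrix T ?B (\<lambda>_. vector [0, vector [0, -1, 0], vector [0, 0, 1]])"
    proof (rule fields_with_matrix_restrictI[OF v], rule frame)
      fix x assume "x \<in> T"
      from base[OF this]
      show "vector [0, vector [0, - ?v x$3 / (x$3)^2, 0], vector [0, ?v x$2, ?v x$3]] + P2_S x ** P2_conn x (?v x)
        = vector [0, vector [0, -1, 0], vector [0, 0, 1]] ** P2_S x"
        by (simp add: mat_simps field_simps power2_eq_square)
    qed
    thus "(\<lambda>x. if x \<in> T then ?v x else 0) \<in>
        (\<Union>g\<in>Lie P2_group. fields_with_matrix T ?B (\<lambda>_. g)) \<union>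
         (\<Union>Y. fields_with_matrix T ?B (\<lambda>t. P2_modular_mat (Y t)))" using P2_Lie_torus by blast
  next
    let ?v = "\<lambda>x::complex^3. \<chi> i::3. if i = 2 then 1 / x$3 else 0"
    assume v: "(\<lambda>x. if x \<in> T then ?v x else 0) \<in> vfields T"
    have "(\<lambda>x. if x \<in> T then ?v x else 0) \<in>
      fields_with_matrix T ?B (\<lambda>_. vector [0, 0, vector [0, 1, 0]])"
    proof (rule fields_with_matrix_restrictI[OF v], rule frame)
      fix x assume "x \<in> T"
      from base[OF this]
      show "vector [0, vector [0, - ?v x$3 / (x$3)^2, 0], vector [0, ?v x$2, ?v x$3]] + P2_S x ** P2_conn x (?v x)
        = vector [0, 0, vector [0, 1, 0]] ** P2_S x"
        by (simp add: mat_simps field_simps power2_eq_square)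
    qed
    thus "(\<lambda>x. if x \<in> T then ?v x else 0) \<in>
        (\<Union>g\<in>Lie P2_group. fields_with_matrix T ?B (\<lambda>_. g)) \<union>
         (\<Union>Y. fields_with_matrix T ?B (\<lambda>t. P2_modular_mat (Y t)))" using P2_Lie_lower by blast
  qed simp_all
qed


section \<open>The Gauss--Manin connection of the mirror of local \<open>F\<^sub>2\<close>\<close>

lemma vector_4 [simp]:
  "(vector [a, b, c, d] :: 'a::zero^4) $ 1 = a"
  "(vector [a, b, c, d] :: 'a::zero^4) $ 2 = b"
  "(vector [a, b, c, d] :: 'a::zero^4) $ 3 = c"
  "(vector [a, b, c, d] :: 'a::zero^4) $ 4 = d"
  unfolding vector_def by simp_all

lemma axis_vector_matrix_mult [simp]:
  fixes M :: "'a::comm_semiring_1^'n^'m"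
  shows "axis k 1 v* M = M $ k"
  by (simp add: vec_eq_iff vector_matrix_mult_def axis_def if_distrib[where f="\<lambda>u. u * x" for x] cong: if_cong)

lemma F2_nabla_const: "F2_nabla A i (\<lambda>_. c) z = c v* A i z"
  by (simp add: F2_nabla_def)

lemma F2_nabla_axis: "F2_nabla A i (\<lambda>_. axis k 1) z = A i z $ k"
  by (simp add: F2_nabla_const)

text \<open>The derivative at \<open>z\<close> sees a section only near \<open>z\<close>. Hence rows
  of the connection matrices known on the open set \<open>V\<close> may be replaced by explicit
  formulas before they are differentiated again.\<close>

lemma F2_nabla_eq:
  assumes "open V" "z \<in> V" "\<And>w. w \<in> V \<Longrightarrow> \<sigma> w = \<tau> w" "(\<tau> has_derivative D) (at z)"
  shows "F2_nabla A i \<sigma> z = z $ i *s D (axis i 1) + \<tau> z v* A i z"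
proof -
  have "(\<sigma> has_derivative D) (at z)"
    by (rule has_derivative_transform_within_open[OF assms(4,1,2)]) (simp add: assms(3))
  from frechet_derivative_at[OF this] show ?thesis
    by (simp add: F2_nabla_def assms(2,3))
qed

lemma F2_nabla_eq_const:
  assumes "open V" "z \<in> V" "\<And>w. w \<in> V \<Longrightarrow> \<sigma> w = c"
  shows "F2_nabla A i \<sigma> z = c v* A i z"
  by (subst F2_nabla_eq[OF assms has_derivative_const]) simp_all

text \<open>One component of the discriminant, the reciprocal of \<open>F2_Y111\<close>.\<close>

definition F2_disc :: "complex^2 \<Rightarrow> complex" where
  "F2_disc z = (1 - 4 * z $ 1)^2 - 64 * (z $ 1)^2 * z $ 2"

text \<open>This is dY = - Y^2 d(disc). With no denominators other than powers of Y, later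
  computations need only the relation Y disc = 1.\<close>

lemma F2_Y111_has_derivative:
  assumes "F2_disc z \<noteq> 0"
  shows "(F2_Y111 has_derivative (\<lambda>h. (F2_Y111 z)^2 *
     ((8 * (1 - 4 * z$1) + 128 * z$1 * z$2) * h$1 + 64 * (z$1)^2 * h$2))) (at z)"
proof -
  have disc: "(F2_disc has_derivative
      (\<lambda>h. - ((8 * (1 - 4 * z$1) + 128 * z$1 * z$2) * h$1 + 64 * (z$1)^2 * h$2))) (at z)"
    unfolding F2_disc_def
    by (rule derivative_eq_intros refl)+ (auto simp: fun_eq_iff algebra_simps power2_eq_square)
  have "((\<lambda>z. 1 / F2_disc z) has_derivative (\<lambda>h. (1 / F2_disc z)^2 *
     ((8 * (1 - 4 * z$1) + 128 * z$1 * z$2) * h$1 + 64 * (z$1)^2 * h$2))) (at z)"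
    by (rule disc[THEN has_derivative_eq_rhs] derivative_eq_intros refl assms)+
       (auto simp: fun_eq_iff assms power2_eq_square divide_inverse algebra_simps)
  thus ?thesis unfolding F2_Y111_def F2_disc_def .
qed

text \<open>The frame is made of derivatives of \<Omega>, which gives row 1 of both matrices and row
  3 of \<open>A 1\<close>. The first Picard-Fuchs equation gives row 2 of \<open>A 1\<close>,
  commutation of the derivatives on \<Omega> gives row 3 of \<open>A 2\<close>, and the second
  equation is linear in row 2 of \<open>A 2\<close>.\<close>

lemma F2_connection_rows:
  assumes conn: "F2_connection V A" and V: "open V" "V \<subseteq> F2_base" and z: "z \<in> V"
  shows "A 1 z $ 1 = vector [0, 0, 1, 0]"
    and "A 1 z $ 2 = vector [0, 0, 2 * z$1, 4 * z$1 * F2_Y111 z]"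
    and "A 1 z $ 3 = vector [0, 0, 0, F2_Y111 z]"
    and "A 2 z $ 1 = vector [0, -1/2, 1/2, 0]"
    and "A 2 z $ 2 = vector [0, 2 * z$2 / (1 - 4 * z$2), - z$1 * (1 + 4 * z$2) / (1 - 4 * z$2),
          F2_Y111 z * ((1 - 4 * z$1) / 2 - 8 * z$1 * z$2) / (1 - 4 * z$2)]"
    and "A 2 z $ 3 = vector [0, 0, - z$1, (1 - 4 * z$1) * F2_Y111 z / 2]"
proof -
  let ?\<Omega> = "\<lambda>_::complex^2. axis 1 1 :: complex^4"
  let ?D12 = "\<lambda>\<sigma> z. F2_nabla A 1 \<sigma> z - 2 *s F2_nabla A 2 \<sigma> z"
  note conn' = conn[unfolded F2_connection_def Let_def, THEN conjunct2, rule_format]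
  have \<Omega>: "A 1 w $ 1 = axis 3 1" "?D12 ?\<Omega> w = axis 2 1"
    "A 2 w $ 1 = (1/2) *s (axis 3 1 - axis 2 1)" if "w \<in> V" for w
  proof -
    show 2: "?D12 ?\<Omega> w = axis 2 1" using conn'[OF that] by blast
    have "F2_nabla A 1 ?\<Omega> w = axis 3 1" using conn'[OF that] by blast
    thus 1: "A 1 w $ 1 = axis 3 1" by (simp only: F2_nabla_axis)
    have "axis 3 1 - 2 *s (A 2 w $ 1) = axis 2 1"
      using 2 unfolding F2_nabla_axis 1 .
    hence "(1/2) *s (axis 3 1 - axis 2 1) = (1/2) *s (2 *s (A 2 w $ 1))"
      by (simp add: algebra_simps)
    thus "A 2 w $ 1 = (1/2) *s (axis 3 1 - axis 2 1)" by simp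
  qed
  \<comment> \<open>First derivatives of \<Omega> have constant coefficients in the frame on all of
    \<open>V\<close>, so differentiating them again only picks out rows of
    \<open>A i\<close>.\<close>
  have D: "F2_nabla A i (F2_nabla A 1 ?\<Omega>) z = A i z $ 3"
    "F2_nabla A i (F2_nabla A 2 ?\<Omega>) z = (1/2) *s (A i z $ 3 - A i z $ 2)"
    "F2_nabla A i (?D12 ?\<Omega>) z = A i z $ 2" for i
  proof -
    have "F2_nabla A i (F2_nabla A 1 ?\<Omega>) z = axis 3 1 v* A i z"
      by (rule F2_nabla_eq_const[OF V(1) z]) (simp only: F2_nabla_axis \<Omega>(1))
    thus "F2_nabla A i (F2_nabla A 1 ?\<Omega>) z = A i z $ 3" by simp
    have "F2_nabla A i (F2_nabla A 2 ?\<Omega>) z = ((1/2) *s (axis 3 1 - axis 2 1)) v* A i z"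
      by (rule F2_nabla_eq_const[OF V(1) z]) (simp only: F2_nabla_axis \<Omega>(3))
    thus "F2_nabla A i (F2_nabla A 2 ?\<Omega>) z = (1/2) *s (A i z $ 3 - A i z $ 2)"
      by (simp add: vec_eq_iff vector_matrix_mult_def axis_def sum_4 algebra_simps)
    have "F2_nabla A i (?D12 ?\<Omega>) z = axis 2 1 v* A i z"
      by (rule F2_nabla_eq_const[OF V(1) z]) (rule \<Omega>(2))
    thus "F2_nabla A i (?D12 ?\<Omega>) z = A i z $ 2" by simp
  qed
  have nz: "1 - 4 * z$2 \<noteq> 0" "F2_Y111 z \<noteq> 0"
    using V(2) z unfolding F2_base_def F2_Y111_def by auto
  show A11: "A 1 z $ 1 = vector [0, 0, 1, 0]" and A21: "A 2 z $ 1 = vector [0, -1/2, 1/2, 0]"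
    using \<Omega>[OF z] by (simp_all add: vec_eq_iff forall_4 axis_def)
  have "inverse (F2_Y111 z) *s A 1 z $ 3 = axis 4 1"
    using conn'[OF z] by (simp add: D)
  hence "F2_Y111 z *s (inverse (F2_Y111 z) *s A 1 z $ 3) = F2_Y111 z *s axis 4 1" by simp
  thus A13: "A 1 z $ 3 = vector [0, 0, 0, F2_Y111 z]"
    using nz by (simp add: vec_eq_iff forall_4 axis_def)
  have "F2_nabla A 1 (?D12 ?\<Omega>) z
      - (2 * z $ 1) *s (2 *s F2_nabla A 1 (F2_nabla A 1 ?\<Omega>) z + F2_nabla A 1 ?\<Omega> z) = 0"
    using conn'[OF z] by blast
  hence "A 1 z $ 2 = (2 * z $ 1) *s (2 *s A 1 z $ 3 + A 1 z $ 1)"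
    unfolding D unfolding F2_nabla_axis by (rule eq_iff_diff_eq_0[THEN iffD2])
  thus A12: "A 1 z $ 2 = vector [0, 0, 2 * z$1, 4 * z$1 * F2_Y111 z]"
    unfolding A13 A11 by (simp add: vec_eq_iff forall_4)
  have "A 2 z $ 3 = (1/2) *s (A 1 z $ 3 - A 1 z $ 2)"
    using conn'[OF z, THEN conjunct1, rule_format, of 1] by (simp add: D)
  thus A23: "A 2 z $ 3 = vector [0, 0, - z$1, (1 - 4 * z$1) * F2_Y111 z / 2]"
    unfolding A13 A12 by (simp add: vec_eq_iff forall_4 left_diff_distrib diff_divide_distrib)
  have "F2_nabla A 2 (F2_nabla A 2 ?\<Omega>) z - z $ 2 *s (?D12 (?D12 ?\<Omega>) z - ?D12 ?\<Omega> z) = 0"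
    using conn'[OF z] by blast
  \<comment> \<open>Row 2 of \<open>A 2\<close> occurs on both sides; collecting it produces the
    factor 1 - 4 z2 that is divided out.\<close>
  hence "(1/2) *s (A 2 z $ 3 - A 2 z $ 2) = z$2 *s (A 1 z $ 2 - 2 *s A 2 z $ 2 - axis 2 1)"
    unfolding \<Omega>(2)[OF z] D by (rule eq_iff_diff_eq_0[THEN iffD2])
  thus "A 2 z $ 2 = vector [0, 2 * z$2 / (1 - 4 * z$2), - z$1 * (1 + 4 * z$2) / (1 - 4 * z$2),
          F2_Y111 z * ((1 - 4 * z$1) / 2 - 8 * z$1 * z$2) / (1 - 4 * z$2)]"
    unfolding A23 A12 using nz(1) by (simp add: vec_eq_iff forall_4 axis_def field_simps)
qed

text \<open>Flatness, applied to \<open>\<omega>\<^sub>3\<close> and \<open>\<omega>\<^sub>2\<close>, gives two linear equations for the last rows of \<open>A 1\<close> and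
  \<open>A 2\<close>; their determinant is \<open>1 / (2 (1 - 4 z\<^sub>2))\<close>.\<close>

lemma F2_connection_row4:
  assumes conn: "F2_connection V A" and V: "open V" "V \<subseteq> F2_base" and z: "z \<in> V"
  shows "A 1 z $ 4 $ 1 = 0" "A 1 z $ 4 $ 2 = 0" "A 1 z $ 4 $ 4 = 0"
    and "A 2 z $ 4 $ 1 = 0" "A 2 z $ 4 $ 2 = 0" "A 2 z $ 4 $ 4 = z $ 1"
proof -
  note rows = F2_connection_rows[OF conn V]
  define Y where "Y = F2_Y111 z"
  define c where "c = inverse (1 - 4 * z$2)"
  define Y' where "Y' = (\<lambda>h::complex^2. Y^2 *
     ((8 * (1 - 4 * z$1) + 128 * z$1 * z$2) * h$1 + 64 * (z$1)^2 * h$2))"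
  have nz: "1 - 4 * z$2 \<noteq> 0" "F2_disc z \<noteq> 0"
    using V(2) z unfolding F2_base_def F2_disc_def by auto
  have Y: "Y * F2_disc z = 1" using nz by (simp add: Y_def F2_Y111_def F2_disc_def)
  have c: "c * (1 - 4 * z$2) = 1" using nz by (simp add: c_def)
  have dY: "(F2_Y111 has_derivative Y') (at z)"
    using F2_Y111_has_derivative[OF nz(2)] unfolding Y'_def Y_def .
  have dc: "((\<lambda>z. inverse (1 - 4 * z$2)) has_derivative (\<lambda>h. 4 * c^2 * h$2)) (at z)"
    by (rule derivative_eq_intros refl nz)+ (auto simp: c_def power2_eq_square)
  note d = dY[THEN has_derivative_eq_rhs] dc[THEN has_derivative_eq_rhs] derivative_eq_intros refl numeral_neq_zero
  have comm: "F2_nabla A 1 (F2_nabla A 2 (\<lambda>_. axis k 1)) z = F2_nabla A 2 (F2_nabla A 1 (\<lambda>_. axis k 1)) z"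
    for k using conn z unfolding F2_connection_def Let_def by blast
  \<comment> \<open>The facts 1 to 4 compute the second derivatives of the third and second frame
    elements in both orders. The products with \<open>A 1 z\<close> and \<open>A 2 z\<close> bring
    in the unknown last rows.\<close>
  have 1: "F2_nabla A 2 (F2_nabla A 1 (\<lambda>_. axis 3 1)) z =
      z$2 *s vector [0, 0, 0, Y' (axis 2 1)] + vector [0, 0, 0, Y] v* A 2 z"
    unfolding Y_def
  proof (rule F2_nabla_eq[OF V(1) z, where D="\<lambda>h. vector [0, 0, 0, Y' h]"])
    show "F2_nabla A 1 (\<lambda>_. axis 3 1) w = vector [0, 0, 0, F2_Y111 w]" if "w \<in> V" for w
      unfolding F2_nabla_axis by (rule rows(3)[OF that])
    have "\<forall>i. ((\<lambda>z. (vector [0, 0, 0, F2_Y111 z] :: complex^4) $ i) has_derivative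
       (\<lambda>h. (vector [0, 0, 0, Y' h] :: complex^4) $ i)) (at z)"
      unfolding forall_4 vector_4 by (intro conjI has_derivative_const dY)
    thus "((\<lambda>z. vector [0, 0, 0, F2_Y111 z] :: complex^4) has_derivative
       (\<lambda>h. vector [0, 0, 0, Y' h])) (at z)"
      by (intro has_derivative_vecI) blast
  qed
  have 2: "F2_nabla A 1 (F2_nabla A 2 (\<lambda>_. axis 3 1)) z =
      z$1 *s vector [0, 0, - (axis 1 1 :: complex^2) $ 1, ((1 - 4 * z$1) * Y' (axis 1 1) - 4 * (axis 1 1 :: complex^2) $ 1 * Y) / 2]
      + vector [0, 0, - z$1, (1 - 4 * z$1) * Y / 2] v* A 1 z"
    unfolding Y_def
  proof (rule F2_nabla_eq[OF V(1) z, where D="\<lambda>h. vector [0, 0, - h$1, ((1 - 4 * z$1) * Y' h - 4 * h$1 * F2_Y111 z) / 2]"])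
    show "F2_nabla A 2 (\<lambda>_. axis 3 1) w = vector [0, 0, - w$1, (1 - 4 * w$1) * F2_Y111 w / 2]"
      if "w \<in> V" for w unfolding F2_nabla_axis by (rule rows(6)[OF that])
    have "((\<lambda>w. - w$1) has_derivative (\<lambda>h. - h$1)) (at z)"
      by (auto intro!: derivative_eq_intros)
    moreover have "((\<lambda>w. (1 - 4 * w$1) * F2_Y111 w / 2) has_derivative
       (\<lambda>h. ((1 - 4 * z$1) * Y' h - 4 * h$1 * F2_Y111 z) / 2)) (at z)"
      by (rule d)+ (auto simp: fun_eq_iff field_simps)
    ultimately have "\<forall>i. ((\<lambda>w. (vector [0, 0, - w$1, (1 - 4 * w$1) * F2_Y111 w / 2] :: complex^4) $ i) has_derivative
       (\<lambda>h. (vector [0, 0, - h$1, ((1 - 4 * z$1) * Y' h - 4 * h$1 * F2_Y111 z) / 2] :: complex^4) $ i)) (at z)"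
      unfolding forall_4 vector_4 by (intro conjI has_derivative_const)
    thus "((\<lambda>w. vector [0, 0, - w$1, (1 - 4 * w$1) * F2_Y111 w / 2] :: complex^4) has_derivative
       (\<lambda>h. vector [0, 0, - h$1, ((1 - 4 * z$1) * Y' h - 4 * h$1 * F2_Y111 z) / 2])) (at z)"
      by (intro has_derivative_vecI) blast
  qed
  have 3: "F2_nabla A 2 (F2_nabla A 1 (\<lambda>_. axis 2 1)) z =
      z$2 *s vector [0, 0, 2 * (axis 2 1 :: complex^2) $ 1, 4 * (axis 2 1 :: complex^2) $ 1 * Y + 4 * z$1 * Y' (axis 2 1)]
      + vector [0, 0, 2 * z$1, 4 * z$1 * Y] v* A 2 z"
    unfolding Y_def
  proof (rule F2_nabla_eq[OF V(1) z, where D="\<lambda>h. vector [0, 0, 2 * h$1, 4 * h$1 * F2_Y111 z + 4 * z$1 * Y' h]"])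
    show "F2_nabla A 1 (\<lambda>_. axis 2 1) w = vector [0, 0, 2 * w$1, 4 * w$1 * F2_Y111 w]"
      if "w \<in> V" for w unfolding F2_nabla_axis by (rule rows(2)[OF that])
    have "((\<lambda>w. 2 * w$1) has_derivative (\<lambda>h. 2 * h$1)) (at z)"
      by (auto intro!: derivative_eq_intros)
    moreover have "((\<lambda>w. 4 * w$1 * F2_Y111 w) has_derivative
       (\<lambda>h. 4 * h$1 * F2_Y111 z + 4 * z$1 * Y' h)) (at z)"
      by (rule d)+ (auto simp: fun_eq_iff)
    ultimately have "\<forall>i. ((\<lambda>w. (vector [0, 0, 2 * w$1, 4 * w$1 * F2_Y111 w] :: complex^4) $ i) has_derivative
       (\<lambda>h. (vector [0, 0, 2 * h$1, 4 * h$1 * F2_Y111 z + 4 * z$1 * Y' h] :: complex^4) $ i)) (at z)"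
      unfolding forall_4 vector_4 by (intro conjI has_derivative_const)
    thus "((\<lambda>w. vector [0, 0, 2 * w$1, 4 * w$1 * F2_Y111 w] :: complex^4) has_derivative
       (\<lambda>h. vector [0, 0, 2 * h$1, 4 * h$1 * F2_Y111 z + 4 * z$1 * Y' h])) (at z)"
      by (intro has_derivative_vecI) blast
  qed
  \<comment> \<open>\<open>g'\<close>, \<open>b'\<close>, \<open>a'\<close> are the differentials of
    entries 2, 3, 4 of row 2 of \<open>A 2\<close>.\<close>
  define b' where "b' = (\<lambda>h::complex^2. - h$1 * (1 + 4 * z$2) * c - z$1 * (4 * h$2) * c
      - z$1 * (1 + 4 * z$2) * (4 * c^2 * h$2))"
  define a' where "a' = (\<lambda>h::complex^2. Y' h * ((1 - 4 * z$1) / 2 - 8 * z$1 * z$2) * c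
      + Y * (- 2 * h$1 - 8 * h$1 * z$2 - 8 * z$1 * h$2) * c
      + Y * ((1 - 4 * z$1) / 2 - 8 * z$1 * z$2) * (4 * c^2 * h$2))"
  define g' where "g' = (\<lambda>h::complex^2. 2 * h$2 * c + 2 * z$2 * (4 * c^2 * h$2))"
  have 4: "F2_nabla A 1 (F2_nabla A 2 (\<lambda>_. axis 2 1)) z =
      z$1 *s vector [0, g' (axis 1 1), b' (axis 1 1), a' (axis 1 1)]
      + vector [0, 2 * z$2 * c, - z$1 * (1 + 4 * z$2) * c, Y * ((1 - 4 * z$1) / 2 - 8 * z$1 * z$2) * c] v* A 1 z"
    unfolding Y_def c_def
  proof (rule F2_nabla_eq[OF V(1) z, where D="\<lambda>h. vector [0, g' h, b' h, a' h]"])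
    let ?s = "\<lambda>w. vector [0, 2 * w$2 * inverse (1 - 4 * w$2), - w$1 * (1 + 4 * w$2) * inverse (1 - 4 * w$2),
          F2_Y111 w * ((1 - 4 * w$1) / 2 - 8 * w$1 * w$2) * inverse (1 - 4 * w$2)] :: complex^4"
    show "F2_nabla A 2 (\<lambda>_. axis 2 1) w = ?s w"
      if "w \<in> V" for w unfolding F2_nabla_axis rows(5)[OF that] by (simp only: divide_inverse)
    have "((\<lambda>w. 2 * w$2 * inverse (1 - 4 * w$2)) has_derivative g') (at z)"
      unfolding g'_def by (rule d)+ (auto simp: c_def fun_eq_iff)
    moreover have "((\<lambda>w. - w$1 * (1 + 4 * w$2) * inverse (1 - 4 * w$2)) has_derivative b') (at z)"
      unfolding b'_def by (rule d)+ (auto simp: c_def fun_eq_iff algebra_simps)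
    moreover have "((\<lambda>w. F2_Y111 w * ((1 - 4 * w$1) / 2 - 8 * w$1 * w$2) * inverse (1 - 4 * w$2))
        has_derivative a') (at z)"
      unfolding a'_def by (rule d)+ (simp add: c_def[symmetric] Y_def[symmetric] fun_eq_iff algebra_simps)
    ultimately have "\<forall>i. ((\<lambda>w. ?s w $ i) has_derivative
       (\<lambda>h. (vector [0, g' h, b' h, a' h] :: complex^4) $ i)) (at z)"
      unfolding forall_4 vector_4 by (intro conjI has_derivative_const)
    thus "(?s has_derivative (\<lambda>h. vector [0, g' h, b' h, a' h])) (at z)"
      by (intro has_derivative_vecI) blast
  qed
  note eq3 = comm[of 3, unfolded 1 2, THEN arg_cong[where f="\<lambda>v. v $ i" for i]]
  note eq2 = comm[of 2, unfolded 3 4, THEN arg_cong[where f="\<lambda>v. v $ i" for i]]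
  note r = rows[OF z, folded Y_def, unfolded divide_inverse, folded c_def]
  note simps = vector_matrix_mult_def sum_4 r axis_def
  have Y2: "Y = Y^2 * ((1 - 4 * z$1)^2 - 64 * (z$1)^2 * z$2)"
    using Y unfolding F2_disc_def power2_eq_square[of Y] by (simp add: algebra_simps)
  \<comment> \<open>Here x and y stand for entries of the last rows of \<open>A 1\<close> and
    \<open>A 2\<close> in one column, and k for the inhomogeneous part. Eliminating Y y - k leaves c
    Y disc x = 0, where Y disc = 1 and c is nonzero.\<close>
  have solve: "x = 0 \<and> Y * y = k"
    if "(1 - 4 * z$1) * Y * x = 2 * (Y * y - k)"
      "Y * (1 - 4 * z$1 - 16 * z$1 * z$2) * c * x = 8 * z$1 * (Y * y - k)" for x y k
  proof -
    have "Y * (1 - 4 * z$1 - 16 * z$1 * z$2) * c * x = 4 * z$1 * ((1 - 4 * z$1) * Y * x)"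
      unfolding that by simp
    hence "c * x = 0"
      using Y c unfolding F2_disc_def by algebra
    moreover have "c \<noteq> 0" using c by auto
    ultimately show ?thesis using that by simp
  qed
  have Y_nz: "Y \<noteq> 0" using Y by auto
  have 1: "A 1 z $ 4 $ 1 = 0 \<and> Y * A 2 z $ 4 $ 1 = 0"
    by (rule solve) (use eq3[of 1] eq2[of 1] in \<open>simp_all add: simps field_simps\<close>)
  have 2: "A 1 z $ 4 $ 2 = 0 \<and> Y * A 2 z $ 4 $ 2 = 0"
    by (rule solve) (use eq3[of 2] eq2[of 2] in \<open>simp_all add: simps g'_def field_simps\<close>)
  have 4: "A 1 z $ 4 $ 4 = 0 \<and> Y * A 2 z $ 4 $ 4 = z$1 * Y"
  proof (rule solve)
    show "(1 - 4 * z$1) * Y * A 1 z $ 4 $ 4 = 2 * (Y * A 2 z $ 4 $ 4 - z$1 * Y)"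
      using eq3[of 4] Y2 by (simp add: simps Y'_def) algebra
    show "Y * (1 - 4 * z$1 - 16 * z$1 * z$2) * c * A 1 z $ 4 $ 4 = 8 * z$1 * (Y * A 2 z $ 4 $ 4 - z$1 * Y)"
      using eq2[of 4] Y2 c by (simp add: simps a'_def Y'_def) algebra
  qed
  show "A 1 z $ 4 $ 1 = 0" "A 1 z $ 4 $ 2 = 0" "A 1 z $ 4 $ 4 = 0"
    and "A 2 z $ 4 $ 1 = 0" "A 2 z $ 4 $ 2 = 0" "A 2 z $ 4 $ 4 = z $ 1"
    using 1 2 4 Y_nz by auto
qed


section \<open>The mirror of local \<open>F\<^sub>2\<close>\<close>

lemma F2_z_has_derivative: "(F2_z has_derivative F2_z) (at x)"
proof (rule has_derivative_vecI)
  have "\<forall>i. ((\<lambda>x. F2_z x $ i) has_derivative (\<lambda>h. F2_z h $ i)) (at x)"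
    unfolding forall_2 F2_z_def vector_2
    by (intro conjI has_derivative_vec_nth has_derivative_ident)
  thus "((\<lambda>x. F2_z x $ i) has_derivative (\<lambda>h. F2_z h $ i)) (at x)" for i by blast
qed

text \<open>Pulls the connection coefficients back from the base to the moduli space;
  \<open>F2_z\<close> is complex linear.\<close>

lemma holo_on_F2_z:
  assumes "holo_on V f" "\<And>x. x \<in> T \<Longrightarrow> F2_z x \<in> V"
  shows "holo_on T (\<lambda>x. f (F2_z x))"
proof -
  obtain L where L: "\<And>x. x \<in> V \<Longrightarrow> (f has_derivative L x) (at x)"
    "\<And>x c h. x \<in> V \<Longrightarrow> L x (c *s h) = c * L x h"
    using assms(1) holo_onE by blast
  have "F2_z (c *s h) = c *s F2_z h" for c h
    by (simp add: vec_eq_iff forall_2 F2_z_def)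
  moreover have "((\<lambda>x. f (F2_z x)) has_derivative (\<lambda>h. L (F2_z x) (F2_z h))) (at x)" if "x \<in> T" for x
    using diff_chain_at[OF F2_z_has_derivative L(1)[OF assms(2)[OF that]]] by (simp only: o_def)
  ultimately show ?thesis
    using L(2) assms(2) by (intro holo_onI[where L="\<lambda>x h. L (F2_z x) (F2_z h)"]) simp_all
qed

lemma F2_S_has_derivative:
  assumes "x $ 6 \<noteq> 0"
  shows "(F2_S has_derivative (\<lambda>v. vector [0, vector [0, v$3, v$4, 0],
     vector [0, 0, - v$6 / (x$6)^2, 0], vector [0, 0, v$5, v$6]])) (at x)"
proof (rule has_derivative_vecI, rule has_derivative_vecI)
  let ?D = "\<lambda>v. vector [0, vector [0, v$3, v$4, 0],
     vector [0, 0, - v$6 / (x$6)^2, 0], vector [0, 0, v$5, v$6]] :: complex^4^4"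
  have inv: "((\<lambda>x. inverse (x $ 6)) has_derivative (\<lambda>v. - v$6 / (x$6)^2)) (at x)"
    using assms by (auto intro!: derivative_eq_intros simp: power2_eq_square field_simps)
  have "\<forall>i j. ((\<lambda>x. F2_S x $ i $ j) has_derivative (\<lambda>v. ?D v $ i $ j)) (at x)"
    unfolding forall_4 F2_S_def F2_Smat_def vector_4 zero_index
    by (intro conjI inv has_derivative_const has_derivative_vec_nth has_derivative_ident)
  thus "((\<lambda>x. F2_S x $ i $ j) has_derivative (\<lambda>v. ?D v $ i $ j)) (at x)" for i j by blast
qed

lemma F2_Smat_right_inverse:
  "u \<noteq> 0 \<Longrightarrow> b \<noteq> 0 \<Longrightarrow>
    F2_Smat u s a b ** F2_Smat (inverse u) (- s * b / u) (- a) (inverse b) = mat 1"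
  by (simp add: vec_eq_iff matrix_matrix_mult_def forall_4 sum_4 F2_Smat_def mat_def)

lemma invertible_F2_S: "x $ 3 \<noteq> 0 \<Longrightarrow> x $ 6 \<noteq> 0 \<Longrightarrow> invertible (F2_S x)"
  unfolding F2_S_def invertible_right_inverse using F2_Smat_right_inverse by blast

lemma open_F2_moduli:
  assumes "open V0" "openin (top_of_set F2_group) U0"
  shows "open (F2_moduli V0 U0)"
proof -
  let ?T = "{t. F2_z t \<in> V0 \<and> t $ 3 \<noteq> 0 \<and> t $ 6 \<noteq> 0}"
  have "continuous_on UNIV F2_z"
    using has_derivative_continuous[OF F2_z_has_derivative]
    by (intro continuous_at_imp_continuous_on) blast
  hence "open (F2_z -` V0)" by (rule open_vimage[OF assms(1)])
  moreover have "?T = (F2_z -` V0) \<inter> ((\<lambda>t. t $ 3) -` (- {0})) \<inter> ((\<lambda>t. t $ 6) -` (- {0}))" by auto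
  ultimately have T: "open ?T"
    by (auto intro!: open_Int open_vimage continuous_intros)
  have "continuous_on ?T F2_S"
    using has_derivative_continuous[OF F2_S_has_derivative]
    by (intro continuous_at_imp_continuous_on) blast
  moreover have "F2_S ` ?T \<subseteq> F2_group" unfolding F2_S_def F2_group_def by auto
  ultimately show ?thesis
    using open_preimage_openin[OF assms(2) T] unfolding F2_moduli_def by (simp add: conj_assoc)
qed

text \<open>Tangent to the curve s44 = 1 + t through the identity; its field is the Euler field of
  s43, s44.\<close>

lemma F2_Lie_torus: "vector [0, 0, vector [0, 0, -1, 0], vector [0, 0, 0, 1]] \<in> Lie F2_group"
  unfolding Lie_def mem_Collect_eq
proof (intro exI[of _ "\<lambda>t. F2_Smat 1 0 0 (1 + t)"] conjI)
  show "F2_Smat 1 0 0 (1 + 0) = mat 1"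
    by (simp add: vec_eq_iff forall_4 F2_Smat_def mat_def)
  have "\<forall>\<^sub>F t in nhds 0. t \<noteq> (- 1 :: complex)" by (rule t1_space_nhds) simp
  thus "\<forall>\<^sub>F t in nhds 0. F2_Smat 1 0 0 (1 + t) \<in> F2_group"
    unfolding F2_group_def
    by eventually_elim
       (intro CollectI exI[of _ 1] exI[of _ 0] exI[of _ "1 + _"], simp add: add_eq_0_iff)
  show "\<forall>i j. ((\<lambda>t. F2_Smat 1 0 0 (1 + t) $ i $ j) has_field_derivative
      (vector [0, 0, vector [0, 0, -1, 0], vector [0, 0, 0, 1]] :: complex^4^4) $ i $ j) (at 0)"
    unfolding forall_4 F2_Smat_def by (auto intro!: derivative_eq_intros)
qed

lemma F2_Lie_lower: "vector [0, 0, 0, vector [0, 0, 1, 0]] \<in> Lie F2_group"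
  unfolding Lie_def mem_Collect_eq
proof (intro exI[of _ "\<lambda>t. F2_Smat 1 0 t 1"] conjI)
  show "F2_Smat 1 0 0 1 = mat 1"
    by (simp add: vec_eq_iff forall_4 F2_Smat_def mat_def)
  show "\<forall>\<^sub>F t in nhds 0. F2_Smat 1 0 t 1 \<in> F2_group"
    unfolding F2_group_def
    by (intro always_eventually allI CollectI exI[of _ 1] exI[of _ 0] exI) simp
  show "\<forall>i j. ((\<lambda>t. F2_Smat 1 0 t 1 $ i $ j) has_field_derivative
      (vector [0, 0, 0, vector [0, 0, 1, 0]] :: complex^4^4) $ i $ j) (at 0)"
    unfolding forall_4 F2_Smat_def by (auto intro!: derivative_eq_intros)
qed

lemma F2_sl2:
  assumes V0: "open V0" "V0 \<noteq> {}" "V0 \<subseteq> F2_base"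
    and U0: "openin (top_of_set F2_group) U0" "mat 1 \<in> U0" and conn: "F2_connection V0 A"
  shows "\<exists>L. lie_subalgebra (F2_moduli V0 U0) L (F2_gauss_manin A V0 U0) \<and>
             isomorphic_sl2 (F2_moduli V0 U0) L"
proof -
  define T where "T = F2_moduli V0 U0"
  let ?B = "frame_change F2_S (F2_conn A)"
  \<comment> \<open>\<open>(x $ 6)\<^sup>2\<close> times \<open>W1\<close>, \<open>W2\<close> are the components of \<open>R\<^sub>1\<close> along \<open>\<theta>\<^sub>1\<close>, \<open>\<theta>\<^sub>2\<close>: by Cramer's rule they
    solve \<open>P 3 4 = 1\<close>, \<open>P 2 4 = - s\<^sub>2\<^sub>3 / s\<^sub>2\<^sub>2\<close>, which are the entries \<open>(3, 4)\<close>, \<open>(2, 4)\<close> of the equation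
    for \<open>R\<^sub>1\<close>.\<close>
  define W1 where "W1 = (\<lambda>x::complex^6. 1 - 4 * x$1 - 16 * x$1 * x$2 + (1 - 4 * x$1) * (1 - 4 * x$2) * (x$4 / x$3))"
  define W2 where "W2 = (\<lambda>x::complex^6. - 2 * (1 - 4 * x$2) * (x$4 / x$3 + 4 * x$1))"
  \<comment> \<open>The connection matrix along W1 \<theta>1 + W2 \<theta>2.\<close>
  define P where "P = (\<lambda>k l (x::complex^6). W1 x * A 1 (F2_z x) $ k $ l + W2 x * A 2 (F2_z x) $ k $ l)"
  \<comment> \<open>Entries (2, 2), (2, 3), (4, 3), (3, 3) of the equation for R1, solved for the
    components along s22, s23, s43, s44, give \<open>G 3\<close> to \<open>G 6\<close>.\<close>
  define G where "G = (\<lambda>(i::6) (x::complex^6). if i = 1 then x$1 * W1 x else if i = 2 then x$2 * W2 x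
      else if i = 3 then - x$3 * P 2 2 x else if i = 4 then - x$3 * P 2 3 x - x$4 * P 3 3 x
      else if i = 5 then P 4 3 x else if i = 6 then P 3 3 x else 0)"
  obtain z0 where z0: "z0 \<in> V0" using V0(2) by blast
  have inV: "F2_z x \<in> V0" if "x \<in> T" for x
    using that unfolding T_def F2_moduli_def by auto
  have z_nth: "F2_z x $ 1 = x$1" "F2_z x $ 2 = x$2" for x by (simp_all add: F2_z_def)
  have base: "x$1 \<noteq> 0" "x$2 \<noteq> 0" "1 - 4 * x$2 \<noteq> 0" "x$3 \<noteq> 0" "x$6 \<noteq> 0"
     "F2_disc (F2_z x) \<noteq> 0" if "x \<in> T" for x
    using that V0(3) subsetD[OF V0(3) inV[OF that]]
    unfolding T_def F2_moduli_def F2_base_def F2_disc_def by (auto simp: z_nth)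
  have frame: "?B x v = M" if x: "x \<in> T"
      and eq: "vector [0, vector [0, v$3, v$4, 0], vector [0, 0, - v$6 / (x$6)^2, 0], vector [0, 0, v$5, v$6]]
         + F2_S x ** F2_conn A x v = M ** F2_S x" for x v M
    by (rule frame_change_eqI[OF F2_S_has_derivative invertible_F2_S]) (use base[OF x] eq in simp_all)
  \<comment> \<open>The equation for R1 has more entries than unknowns. These values make the
    remaining ones consistent; in particular entry (4, 4) needs \<open>P 4 4 x = - P 3 3 x\<close>,
    which comes from the last rows found by flatness.\<close>
  have P: "P 1 1 x = 0" "P 1 2 x = - W2 x / 2" "P 1 3 x = W1 x + W2 x / 2" "P 1 4 x = 0"
    "P 2 1 x = 0" "P 2 4 x = - x$4 / x$3"
    "P 3 1 x = 0" "P 3 2 x = 0" "P 3 4 x = 1"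
    "P 4 1 x = 0" "P 4 2 x = 0" "P 4 4 x = - P 3 3 x" if x: "x \<in> T" for x
  proof -
    note rows = F2_connection_rows[OF conn V0(1,3) inV[OF x]]
      F2_connection_row4[OF conn V0(1,3) inV[OF x]]
    define Y where "Y = F2_Y111 (F2_z x)"
    have Y: "Y * ((1 - 4 * x$1)^2 - 64 * (x$1)^2 * x$2) = 1"
      using base(6)[OF x] by (simp add: Y_def F2_Y111_def F2_disc_def z_nth)
    show "P 1 1 x = 0" "P 1 2 x = - W2 x / 2" "P 1 3 x = W1 x + W2 x / 2" "P 1 4 x = 0"
      "P 2 1 x = 0" "P 3 1 x = 0" "P 3 2 x = 0" "P 4 1 x = 0" "P 4 2 x = 0" "P 4 4 x = - P 3 3 x"
      by (simp_all add: P_def rows z_nth)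
    define r where "r = x$4 / x$3"
    have "P 3 4 x = Y * ((1 - 4 * x$1)^2 - 64 * (x$1)^2 * x$2)"
      unfolding P_def rows vector_4 z_nth Y_def[symmetric] W1_def W2_def r_def[symmetric]
      by (simp add: field_simps power2_eq_square)
    thus "P 3 4 x = 1" using Y by simp
    \<comment> \<open>The factor 1 - 4 z2 of \<open>W2\<close> cancels the denominator in row 2 of
      \<open>A 2\<close>.\<close>
    have cancel: "- 2 * (1 - 4 * x$2) * w * (q / (1 - 4 * x$2)) = - 2 * w * q" for w q
    proof -
      have "- 2 * d * w * (q / d) = - 2 * w * q" if "d \<noteq> 0" for d :: complex
        using that by simp
      from this[OF base(3)[OF x]] show ?thesis .
    qed
    have "P 2 4 x = W1 x * (4 * x$1 * Y)
        + - 2 * (r + 4 * x$1) * (Y * ((1 - 4 * x$1) / 2 - 8 * x$1 * x$2))"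
      unfolding P_def rows vector_4 z_nth Y_def[symmetric] W2_def r_def[symmetric] cancel ..
    also have "\<dots> = - (Y * ((1 - 4 * x$1)^2 - 64 * (x$1)^2 * x$2)) * r"
      unfolding W1_def r_def[symmetric] by (simp add: field_simps power2_eq_square)
    finally show "P 2 4 x = - x$4 / x$3" unfolding Y r_def by simp
  qed
  have vert: "F2_conn A x v = 0" if "v$1 = 0" "v$2 = 0" for x v
    using that by (simp add: F2_conn_def scale_mat_def vec_eq_iff)
  note mat_simps = vec_eq_iff matrix_matrix_mult_def forall_4 sum_4 F2_S_def F2_Smat_def
  show ?thesis unfolding F2_gauss_manin_def Let_def T_def[symmetric]
  \<comment> \<open>Positions 5 and 6 hold s43 and s44. The choice k = 2 is safe because
    \<open>W2\<close> equals -8 z1 (1 - 4 z2) at \<open>x0\<close>, which is nonzero on the base,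
    whereas \<open>W1\<close> may vanish there.\<close>
  proof (rule sl2_triple_normal_form[where p=5 and q=6 and k=2 and G=G and
        ?x0.0="\<chi> i. if i = 1 then z0$1 else if i = 2 then z0$2 else if i = 3 \<or> i = 6 then 1 else 0"])
    show "open T" unfolding T_def by (rule open_F2_moduli[OF V0(1) U0(1)])
    show "x $ 6 \<noteq> 0" if "x \<in> T" for x using base that by blast
    have W: "holo_on T W1" "holo_on T W2"
      unfolding W1_def W2_def by (intro holo_on_intros base(4); assumption)+
    have "holo_on V0 (\<lambda>z. A i z $ k $ l)" for i k l
      using conn unfolding F2_connection_def Let_def by blast
    hence "holo_on T (P k l)" for k l
      unfolding P_def by (intro holo_on_add holo_on_mult W holo_on_F2_z[where V=V0]) (auto intro: inV)
    thus "holo_on T (G i)" for i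
      unfolding G_def using W
      by (cases "i = 1"; cases "i = 2"; cases "i = 3"; cases "i = 4"; cases "i = 5"; cases "i = 6")
         (simp_all add: holo_on_intros)
    show "G i x = G i y" if "\<And>j. j \<noteq> 5 \<Longrightarrow> j \<noteq> 6 \<Longrightarrow> x $ j = y $ j" for i x y
    proof -
      have "x$1 = y$1" "x$2 = y$2" "x$3 = y$3" "x$4 = y$4" by (auto intro!: that)
      thus ?thesis by (simp add: G_def P_def W1_def W2_def F2_z_def)
    qed
    let ?x0 = "(\<chi> i. if i = 1 then z0$1 else if i = 2 then z0$2 else if i = 3 \<or> i = 6 then 1 else 0) :: complex^6"
    have "F2_S ?x0 = mat 1" "F2_z ?x0 = z0"
      by (simp_all add: vec_eq_iff forall_4 forall_2 F2_S_def F2_Smat_def F2_z_def mat_def)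
    thus x0: "?x0 \<in> T" using z0 U0(2) by (simp add: T_def F2_moduli_def)
    show "G 2 ?x0 \<noteq> 0" using base[OF x0] by (simp add: G_def W2_def)
  next
    let ?v = "\<lambda>x::complex^6. \<chi> i::6. if i = 5 then - x$5 * (x$6)\<^sup>2 * G 6 x - x$6^3 * G 5 x
        else if i = 6 then x$6^3 * G 6 x - x$5 * (x$6)\<^sup>2 else (x$6)\<^sup>2 * G i x"
    assume v: "(\<lambda>x. if x \<in> T then ?v x else 0) \<in> vfields T"
    \<comment> \<open>Entries (1, 2) and (1, 3) of the equation determine the reciprocals of
      \<open>Y1\<close> and \<open>Y2\<close>. Where such a reciprocal vanishes,
      \<open>inverse 0 = 0\<close> keeps the equation valid.\<close>
    define Y1 where "Y1 = (\<lambda>x::complex^6. inverse (- ((x$6)^2 * W2 x / (2 * x$3))))"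
    define Y2 where "Y2 = (\<lambda>x::complex^6. inverse ((x$6)^3 * (W1 x + W2 x / 2 + x$4 * W2 x / (2 * x$3))))"
    have "(\<lambda>x. if x \<in> T then ?v x else 0) \<in>
      fields_with_matrix T ?B (\<lambda>t. F2_modular_mat1 (Y1 t) (Y2 t))"
    proof (rule fields_with_matrix_restrictI[OF v], rule frame)
      fix x assume x: "x \<in> T"
      note b = base[OF x]
      have conn_v: "F2_conn A x (?v x) $ k $ l = (x$6)^2 * P k l x" for k l
        using b by (simp add: F2_conn_def scale_mat_def P_def G_def algebra_simps)
      show "vector [0, vector [0, ?v x$3, ?v x$4, 0], vector [0, 0, - ?v x$6 / (x$6)^2, 0], vector [0, 0, ?v x$5, ?v x$6]]
         + F2_S x ** F2_conn A x (?v x) = F2_modular_mat1 (Y1 x) (Y2 x) ** F2_S x"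
        using b by (simp add: mat_simps conn_v P[OF x] F2_modular_mat1_def G_def Y1_def Y2_def)
           (simp add: field_simps power2_eq_square power3_eq_cube)
    qed (assumption)
    thus "(\<lambda>x. if x \<in> T then ?v x else 0) \<in>
        (\<Union>g\<in>Lie F2_group. fields_with_matrix T ?B (\<lambda>_. g)) \<union>
         (\<Union>Y1 Y2. fields_with_matrix T ?B (\<lambda>t. F2_modular_mat1 (Y1 t) (Y2 t))) \<union>
         (\<Union>Y3 Y4. fields_with_matrix T ?B (\<lambda>t. F2_modular_mat2 (Y3 t) (Y4 t)))" by blast
  next
    let ?v = "\<lambda>x::complex^6. \<chi> i::6. if i = 5 then x$5 else if i = 6 then x$6 else 0"
    assume v: "(\<lambda>x. if x \<in> T then ?v x else 0) \<in> vfields T"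
    have "(\<lambda>x. if x \<in> T then ?v x else 0) \<in>
      fields_with_matrix T ?B (\<lambda>_. vector [0, 0, vector [0, 0, -1, 0], vector [0, 0, 0, 1]])"
    proof (rule fields_with_matrix_restrictI[OF v], rule frame)
      fix x assume "x \<in> T"
      note b = base[OF this]
      have vert': "F2_conn A x (?v x) = 0" by (rule vert) simp_all
      show "vector [0, vector [0, ?v x$3, ?v x$4, 0], vector [0, 0, - ?v x$6 / (x$6)^2, 0], vector [0, 0, ?v x$5, ?v x$6]]
         + F2_S x ** F2_conn A x (?v x) = vector [0, 0, vector [0, 0, -1, 0], vector [0, 0, 0, 1]] ** F2_S x"
        unfolding vert' using b by (simp add: mat_simps field_simps power2_eq_square)
    qed (assumption)
    thus "(\<lambda>x. if x \<in> T then ?v x else 0) \<in>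
        (\<Union>g\<in>Lie F2_group. fields_with_matrix T ?B (\<lambda>_. g)) \<union>
         (\<Union>Y1 Y2. fields_with_matrix T ?B (\<lambda>t. F2_modular_mat1 (Y1 t) (Y2 t))) \<union>
         (\<Union>Y3 Y4. fields_with_matrix T ?B (\<lambda>t. F2_modular_mat2 (Y3 t) (Y4 t)))" using F2_Lie_torus by blast
  next
    let ?v = "\<lambda>x::complex^6. \<chi> i::6. if i = 5 then 1 / x$6 else 0"
    assume v: "(\<lambda>x. if x \<in> T then ?v x else 0) \<in> vfields T"
    have "(\<lambda>x. if x \<in> T then ?v x else 0) \<in>
      fields_with_matrix T ?B (\<lambda>_. vector [0, 0, 0, vector [0, 0, 1, 0]])"
    proof (rule fields_with_matrix_restrictI[OF v], rule frame)
      fix x assume "x \<in> T"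
      note b = base[OF this]
      have vert': "F2_conn A x (?v x) = 0" by (rule vert) simp_all
      show "vector [0, vector [0, ?v x$3, ?v x$4, 0], vector [0, 0, - ?v x$6 / (x$6)^2, 0], vector [0, 0, ?v x$5, ?v x$6]]
         + F2_S x ** F2_conn A x (?v x) = vector [0, 0, 0, vector [0, 0, 1, 0]] ** F2_S x"
        unfolding vert' using b by (simp add: mat_simps field_simps power2_eq_square)
    qed (assumption)
    thus "(\<lambda>x. if x \<in> T then ?v x else 0) \<in>
        (\<Union>g\<in>Lie F2_group. fields_with_matrix T ?B (\<lambda>_. g)) \<union>
         (\<Union>Y1 Y2. fields_with_matrix T ?B (\<lambda>t. F2_modular_mat1 (Y1 t) (Y2 t))) \<union>
         (\<Union>Y3 Y4. fields_with_matrix T ?B (\<lambda>t. F2_modular_mat2 (Y3 t) (Y4 t)))" using F2_Lie_lower by blast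
  qed simp_all
qed


theorem theorem3:
  shows "(\<forall>(V0::complex set) U0.
            open V0 \<and> V0 \<noteq> {} \<and> V0 \<subseteq> P2_base \<and>
            openin (top_of_set P2_group) U0 \<and> mat 1 \<in> U0 \<longrightarrow>
            (\<exists>L. lie_subalgebra (P2_moduli V0 U0) L (P2_gauss_manin V0 U0) \<and>
                 isomorphic_sl2 (P2_moduli V0 U0) L)) \<and>
         (\<forall>(V0::(complex^2) set) U0 A.
            open V0 \<and> V0 \<noteq> {} \<and> V0 \<subseteq> F2_base \<and>
            openin (top_of_set F2_group) U0 \<and> mat 1 \<in> U0 \<and>
            F2_connection V0 A \<longrightarrow>
            (\<exists>L. lie_subalgebra (F2_moduli V0 U0) L (F2_gauss_manin A V0 U0) \<and>
                 isomorphic_sl2 (F2_moduli V0 U0) L))"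
  using P2_sl2 F2_sl2 by blast

end
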